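(* Let $A\ge 2$ and $C>0$. Then $$\int_0^\infty\left[(w'(s))^2+C\left(\frac{w(s)}{s}\right)^2\right]e^{-s^2/2}s^{A-1}\,ds\ \ge\ \frac{-(A-2)+\sqrt{(A-2)^2+4C}}{2}\int_0^\infty w^2(s)\,e^{-s^2/2}s^{A-1}\,ds.$$ The equality holds if and only if $w(s)=c\,s^{\frac{-(A-2)+\sqrt{(A-2)^2+4C}}{2}}$, where $c$ is a constant. Moreover, $$\int_0^\infty\left[(w'(s))^2+C\left(\frac{w(s)}{s}\right)^2\right]e^{-s^2/2}s^{A-1}\,ds-\frac{-(A-2)+\sqrt{(A-2)^2+4C}}{2}\int_0^\infty w^2(s)\,s^{A-1}e^{-s^2/2}\,ds$$ $$\ge\ 2\inf_{c\in\mathbb{R}}\int_0^\infty\left|w(s)-c\,s^{\frac{-(A-2)+\sqrt{(A-2)^2+4C}}{2}}\right|^2e^{-s^2/2}s^{A-1}\,ds.$$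
   Context: Here $w$ denotes a real-valued function on $(0,\infty)$ and $w'$ its derivative; the source states the inequalities without specifying a function class for $w$. *)

theory Defs
  imports "HOL-Analysis.Analysis"
begin

text \<open>
  The admissible functions on the open half-line are those that are an indefinite integral of their
  own derivative. The integral is the Henstock--Kurzweil one, so by the fundamental theorem of
  calculus every function that is differentiable at all \<open>s > 0\<close> is admissible, and by Lebesgue's
  theorem so is every locally absolutely continuous function (the continuous representative of a
  locally Sobolev function); \<open>deriv w\<close> is then defined almost everywhere and is the weak derivative.
  No integrability at \<open>0\<close> or at infinity is required. Values of \<open>w\<close> outside
  \<open>{0<..}\<close> play no role.
\<close>

definition admissible :: "(real \<Rightarrow> real) \<Rightarrow> bool" where
  "admissible w \<longleftrightarrow>
     (\<forall>a b. 0 < a \<and> a \<le> b \<longrightarrow> (deriv w has_integral (w b - w a)) {a..b})"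

lemma admissible_if_differentiable:
  assumes "\<And>s. 0 < s \<Longrightarrow> w differentiable (at s)"
  shows "admissible w"
  unfolding admissible_def
proof (intro allI impI)
  fix a b :: real
  assume ab: "0 < a \<and> a \<le> b"
  show "(deriv w has_integral (w b - w a)) {a..b}"
  proof (rule fundamental_theorem_of_calculus)
    fix x assume "x \<in> {a..b}"
    with ab have "0 < x" by auto
    from assms[OF this] have "(w has_field_derivative deriv w x) (at x)"
      by (simp add: DERIV_deriv_iff_real_differentiable)
    then show "(w has_vector_derivative deriv w x) (at x within {a..b})"
      by (simp add: has_real_derivative_iff_has_vector_derivative
          has_vector_derivative_at_within)
  qed (use ab in simp)
qed

text \<open>
  Both integrals have nonnegative integrands and are taken with values in \<open>[0, \<infinity>]\<close>, so that no
  finiteness has to be assumed. Lebesgue rather than Borel measure is used because \<open>deriv w\<close> is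
  only determined almost everywhere.
\<close>

definition gauss_energy :: "real \<Rightarrow> real \<Rightarrow> (real \<Rightarrow> real) \<Rightarrow> ennreal" where
  "gauss_energy A C w =
     (\<integral>\<^sup>+s\<in>{0<..}. ennreal (((deriv w s)\<^sup>2 + C * (w s / s)\<^sup>2) * exp (- s\<^sup>2 / 2) * s powr (A - 1))
        \<partial>lebesgue)"

definition gauss_mass :: "real \<Rightarrow> (real \<Rightarrow> real) \<Rightarrow> ennreal" where
  "gauss_mass A w =
     (\<integral>\<^sup>+s\<in>{0<..}. ennreal (\<bar>w s\<bar>\<^sup>2 * exp (- s\<^sup>2 / 2) * s powr (A - 1)) \<partial>lebesgue)"

definition crit_exp :: "real \<Rightarrow> real \<Rightarrow> real" where
  "crit_exp A C = (- (A - 2) + sqrt ((A - 2)\<^sup>2 + 4 * C)) / 2"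

end

theory Submission
  imports Defs "HOL-Real_Asymp.Real_Asymp"
begin

text \<open>
  The ground state substitution: with \<open>q = crit_exp A C\<close>, \<open>w = s\<^sup>q v\<close> and \<open>B = 2 q + A\<close>, expanding the
  square turns the integrand of the energy into
  \<open>q w\<^sup>2 s\<^bsup>A-1\<^esup> e\<^bsup>-s\<^sup>2/2\<^esup> + v'\<^sup>2 s\<^bsup>B-1\<^esup> e\<^bsup>-s\<^sup>2/2\<^esup> + q G'\<close>, where \<open>G = w\<^sup>2 s\<^bsup>A-2\<^esup> e\<^bsup>-s\<^sup>2/2\<^esup>\<close>.
  Finite energy forces \<open>G\<close> to be small along a sequence tending to \<open>0\<close>, and \<open>G \<ge> 0\<close> takes care of
  infinity, so the deficit is at least \<open>\<integral> v'\<^sup>2 s\<^bsup>B-1\<^esup> e\<^bsup>-s\<^sup>2/2\<^esup>\<close>.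

  It remains to prove the Poincare inequality with constant \<open>2\<close> for the probability measure \<open>\<mu>\<close> with
  density \<open>\<rho>\<close> proportional to \<open>s\<^bsup>B-1\<^esup> e\<^bsup>-s\<^sup>2/2\<^esup>\<close>. For \<open>y < x\<close>, Cauchy--Schwarz against the derivative of
  the optimizer \<open>s\<^sup>2\<close> gives \<open>(v x - v y)\<^sup>2 \<le> (x\<^sup>2 - y\<^sup>2) \<integral>\<^bsub>y\<^esub>\<^bsup>x\<^esup> v'(t)\<^sup>2 / (2 t) dt\<close>. Integrating in \<open>x\<close> and \<open>y\<close>
  and exchanging the integrals, the weight of \<open>v'(t)\<^sup>2 / (2 t)\<close> becomes
  \<open>\<integral>\<integral>\<^bsub>y<t<x\<^esub> (x\<^sup>2 - y\<^sup>2) d\<mu> d\<mu> = t \<rho>(t)\<close>.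
\<close>

section \<open>Lebesgue indefinite integrals on the half-line\<close>

text \<open>The Lebesgue counterpart of \<open>admissible\<close>, that is, local absolute
  continuity. The integrand is an explicit argument because it may be any representative of the
  derivative; absolute integrability is what Fubini needs for the product rule.\<close>

definition indef_int :: "(real \<Rightarrow> real) \<Rightarrow> (real \<Rightarrow> real) \<Rightarrow> bool" where
  "indef_int f f' \<longleftrightarrow> (\<forall>a b. 0 < a \<longrightarrow> a \<le> b \<longrightarrow>
     set_integrable lborel {a..b} f' \<and> (LBINT x:{a..b}. f' x) = f b - f a)"

lemma indef_intD:
  assumes "indef_int f f'" "0 < a" "a \<le> b"
  shows "set_integrable lborel {a..b} f'" "(LBINT x:{a..b}. f' x) = f b - f a"
  using assms unfolding indef_int_def by auto

lemma indef_int_C1: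
  assumes d: "\<And>x. 0 < x \<Longrightarrow> (f has_real_derivative f' x) (at x)"
    and c: "continuous_on {0<..} f'"
  shows "indef_int f f'"
  unfolding indef_int_def
proof (intro allI impI)
  fix a b :: real assume ab: "0 < a" "a \<le> b"
  have c': "continuous_on {a..b} f'"
    by (rule continuous_on_subset[OF c]) (use ab in auto)
  have "has_bochner_integral lborel (\<lambda>x. f' x * indicator {a..b} x) (f b - f a)"
  proof (rule has_bochner_integral_FTC_Icc_real)
    fix x assume "a \<le> x" "x \<le> b"
    then have x: "0 < x" using ab by simp
    show "(f has_real_derivative f' x) (at x)" by (rule d[OF x])
    show "isCont f' x" using c x by (simp add: continuous_on_eq_continuous_at)
  qed (fact ab)
  then show "set_integrable lborel {a..b} f' \<and> (LBINT x:{a..b}. f' x) = f b - f a"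
    unfolding set_integrable_def set_lebesgue_integral_def has_bochner_integral_iff
    by (simp add: mult.commute)
qed

text \<open>Source of the Borel measurability of admissible functions. Around each point
  \<open>f\<close> is a constant plus an indefinite Henstock--Kurzweil integral, which is
  continuous.\<close>

lemma continuous_on_HK_primitive:
  fixes f f' :: "real \<Rightarrow> real"
  assumes f: "\<And>a b. 0 < a \<Longrightarrow> a \<le> b \<Longrightarrow> (f' has_integral (f b - f a)) {a..b}"
  shows "continuous_on {0<..} f"
proof -
  have "isCont f x" if x: "0 < x" for x
  proof -
    let ?a = "x / 2" and ?b = "2 * x"
    have "f' integrable_on {?a..?b}"
      using f[of ?a ?b] x by (auto simp: integrable_on_def)
    then have "continuous_on {?a..?b} (\<lambda>y. integral {?a..y} f')"
      by (rule indefinite_integral_continuous_1)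
    then have "continuous_on {?a..?b} (\<lambda>y. f ?a + integral {?a..y} f')"
      by (intro continuous_intros)
    moreover have "f ?a + integral {?a..y} f' = f y" if "y \<in> {?a..?b}" for y
      using integral_unique[OF f[of ?a y]] that x by simp
    ultimately have "continuous_on {?a..?b} f"
      by (rule continuous_on_eq)
    then show ?thesis
      using x by (intro continuous_on_interior[of "{?a..?b}"]) (auto simp: interior_atLeastAtMost_real)
  qed
  then show ?thesis by (simp add: continuous_on_eq_continuous_at)
qed

text \<open>Fubini for \<open>f' s * g' t\<close> on the triangle \<open>a \<le> t < s \<le> b\<close>.\<close>

lemma indef_int_mult:
  assumes f: "indef_int f f'" and g: "indef_int g g'"
  shows "indef_int (\<lambda>x. f x * g x) (\<lambda>x. f' x * g x + f x * g' x)"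
  unfolding indef_int_def
proof (intro allI impI)
  fix a b :: real assume ab: "0 < a" "a \<le> b"
  define F G where "F = (\<lambda>s. indicator {a..b} s * f' s)" and "G = (\<lambda>t. indicator {a..b} t * g' t)"
  have F: "integrable lborel F" and G: "integrable lborel G"
    using indef_intD(1)[OF f ab] indef_intD(1)[OF g ab]
    unfolding F_def G_def set_integrable_def by simp_all
  have [measurable]: "F \<in> borel_measurable borel" "G \<in> borel_measurable borel"
    using F G by (auto dest: borel_measurable_integrable)
  have IF: "(\<integral>s. F s \<partial>lborel) = f b - f a" and IG: "(\<integral>t. G t \<partial>lborel) = g b - g a"
    using indef_intD(2)[OF f ab] indef_intD(2)[OF g ab]
    unfolding F_def G_def set_lebesgue_integral_def by simp_all
  define H where "H = (\<lambda>(t, s). G t * F s * indicator {(t, s). t < s} (t, s))"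
  have mH [measurable]: "H \<in> borel_measurable (lborel \<Otimes>\<^sub>M lborel)"
    unfolding H_def by measurable
  have "integrable (lborel \<Otimes>\<^sub>M lborel) (\<lambda>(t, s). G t * F s)"
    using F G by (subst lborel_pair.Fubini_integrable)
       (auto simp: abs_mult split_beta' integrable_abs)
  then have H: "integrable (lborel \<Otimes>\<^sub>M lborel) H"
    by (rule Bochner_Integration.integrable_bound) (auto simp: H_def indicator_def)
  \<comment> \<open>Integrating out one variable over the triangle leaves an increment of the other
    function. The diagonal is a null set, so the half-open section may be closed.\<close>
  have fst: "(\<integral>s. H (t, s) \<partial>lborel) = G t * (f b - f t)" for t
  proof (cases "t \<in> {a..b}")
    case True
    have "(\<integral>s. H (t, s) \<partial>lborel) = (\<integral>s. G t * (indicator {t..b} s * f' s) \<partial>lborel)"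
    proof (rule integral_cong_AE)
      show "AE s in lborel. H (t, s) = G t * (indicator {t..b} s * f' s)"
        using AE_lborel_singleton[of t] by eventually_elim (use True in \<open>auto simp: H_def F_def indicator_def\<close>)
      have "(\<lambda>s. indicator {t..b} s * F s) \<in> borel_measurable borel" by measurable
      moreover have "(\<lambda>s. indicator {t..b} s * F s) = (\<lambda>s. indicator {t..b} s * f' s)"
        using True by (auto simp: F_def indicator_def)
      ultimately have [measurable]: "(\<lambda>s. indicator {t..b} s * f' s) \<in> borel_measurable borel" by simp
      show "(\<lambda>s. G t * (indicator {t..b} s * f' s)) \<in> borel_measurable lborel" by measurable
      show "(\<lambda>s. H (t, s)) \<in> borel_measurable lborel" by measurable
    qed
    also have "\<dots> = G t * (f b - f t)"
      using indef_intD(2)[OF f, of t b] True ab by (simp add: set_lebesgue_integral_def)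
    finally show ?thesis .
  qed (simp add: H_def G_def)
  have snd: "(\<integral>t. H (t, s) \<partial>lborel) = F s * (g s - g a)" for s
  proof (cases "s \<in> {a..b}")
    case True
    have "(\<integral>t. H (t, s) \<partial>lborel) = (\<integral>t. F s * (indicator {a..s} t * g' t) \<partial>lborel)"
    proof (rule integral_cong_AE)
      show "AE t in lborel. H (t, s) = F s * (indicator {a..s} t * g' t)"
        using AE_lborel_singleton[of s] by eventually_elim (use True in \<open>auto simp: H_def G_def indicator_def\<close>)
      have "(\<lambda>t. indicator {a..s} t * G t) \<in> borel_measurable borel" by measurable
      moreover have "(\<lambda>t. indicator {a..s} t * G t) = (\<lambda>t. indicator {a..s} t * g' t)"
        using True by (auto simp: G_def indicator_def)
      ultimately have [measurable]: "(\<lambda>t. indicator {a..s} t * g' t) \<in> borel_measurable borel" by simp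
      show "(\<lambda>t. F s * (indicator {a..s} t * g' t)) \<in> borel_measurable lborel" by measurable
      show "(\<lambda>t. H (t, s)) \<in> borel_measurable lborel" by measurable
    qed
    also have "\<dots> = F s * (g s - g a)"
      using indef_intD(2)[OF g, of a s] True ab by (simp add: set_lebesgue_integral_def)
    finally show ?thesis .
  qed (simp add: H_def F_def)
  have i1: "integrable lborel (\<lambda>t. G t * (f b - f t))"
    using lborel_pair.integrable_fst'[OF H] by (simp add: fst)
  have i2: "integrable lborel (\<lambda>s. F s * (g s - g a))"
    using lborel_pair.integrable_snd[of "\<lambda>t s. H (t, s)"] H by (simp add: snd)
  have eq: "(\<integral>t. G t * (f b - f t) \<partial>lborel) = (\<integral>s. F s * (g s - g a) \<partial>lborel)"
    using lborel_pair.Fubini_integral[of "\<lambda>t s. H (t, s)"] H by (simp add: fst snd)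
  \<comment> \<open>The two iterated integrals of \<open>H\<close> enter with opposite signs and
    cancel by \<open>eq\<close>. What remains is
    \<open>g a * (f b - f a) + f b * (g b - g a)\<close>.\<close>
  have split: "indicator {a..b} x * (f' x * g x + f x * g' x)
      = (F x * (g x - g a) + g a * F x) + (f b * G x - G x * (f b - f x))" for x
    by (simp add: F_def G_def algebra_simps)
  have "has_bochner_integral lborel
      (\<lambda>x. (F x * (g x - g a) + g a * F x) + (f b * G x - G x * (f b - f x)))
      (((\<integral>s. F s * (g s - g a) \<partial>lborel) + g a * (f b - f a)) +
        (f b * (g b - g a) - (\<integral>s. F s * (g s - g a) \<partial>lborel)))"
    using i1 i2 F G IF IG eq
    by (intro has_bochner_integral_add has_bochner_integral_diff has_bochner_integral_mult_right
        has_bochner_integral_integrable) (auto simp: has_bochner_integral_iff)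
  then show "set_integrable lborel {a..b} (\<lambda>x. f' x * g x + f x * g' x)
     \<and> (LBINT x:{a..b}. f' x * g x + f x * g' x) = f b * g b - f a * g a"
    unfolding set_integrable_def set_lebesgue_integral_def real_scaleR_def split
    by (simp only: has_bochner_integral_iff) (simp add: algebra_simps)
qed

section \<open>The Gaussian weight and its moments\<close>

text \<open>From \<open>(s - 1)\<^sup>2 \<ge> 0\<close> the Gaussian factor is at most
  \<open>exp (1/2) / exp s\<close>, so a multiple of the Gamma integrand dominates.\<close>

lemma set_integrable_gauss_powr:
  assumes "p > -1"
  shows "set_integrable lborel {0<..} (\<lambda>s::real. s powr p * exp (- s\<^sup>2 / 2))"
proof -
  have g: "integrable lborel (\<lambda>t::real. indicator {0..} t * t powr p / exp t)"
  proof (rule integrableI_nonneg)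
    show "(\<integral>\<^sup>+ t. ennreal (indicator {0..} t * t powr p / exp t) \<partial>lborel) < \<infinity>"
      using Gamma_conv_nn_integral_real[of "p + 1"] assms by (auto simp: less_top[symmetric] dest: sym)
  qed auto
  show ?thesis
    unfolding set_integrable_def
  proof (rule Bochner_Integration.integrable_bound[OF integrable_mult_right[OF g, of "exp (1/2)"]])
    show "AE s in lborel. norm (indicator {0<..} s *\<^sub>R (s powr p * exp (- s\<^sup>2 / 2)))
        \<le> norm (exp (1/2) * (indicator {0..} s * s powr p / exp s))"
    proof (intro AE_I2)
      fix s :: real
      have "0 \<le> (s - 1)\<^sup>2" by simp
      then have "- s\<^sup>2 / 2 \<le> 1/2 - s" by (simp add: power2_eq_square algebra_simps)
      then have "exp (- s\<^sup>2 / 2) \<le> exp (1/2 - s)" by simp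
      also have "\<dots> = exp (1/2) / exp s" by (simp add: exp_diff)
      finally have "s powr p * exp (- s\<^sup>2 / 2) \<le> s powr p * (exp (1/2) / exp s)"
        by (intro mult_left_mono) auto
      then show "norm (indicator {0<..} s *\<^sub>R (s powr p * exp (- s\<^sup>2 / 2)))
        \<le> norm (exp (1/2) * (indicator {0..} s * s powr p / exp s))"
        by (auto simp: indicator_def abs_mult mult.commute)
    qed
  qed measurable
qed

text \<open>Up to normalization this is the radial density of a standard Gaussian in dimension
  \<open>B\<close>, with \<open>B\<close> real. The value zero off the half-line lets integrals run
  over all of \<open>lborel\<close>.\<close>

definition gauss_weight :: "real \<Rightarrow> real \<Rightarrow> real" where
  "gauss_weight B s = (if 0 < s then s powr (B - 1) * exp (- s\<^sup>2 / 2) else 0)"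

lemma gauss_weight_nonneg [simp]: "0 \<le> gauss_weight B s"
  by (simp add: gauss_weight_def)

lemma measurable_gauss_weight [measurable]: "gauss_weight B \<in> borel_measurable borel"
  unfolding gauss_weight_def by measurable

lemma integrable_gauss_weight:
  assumes "B > 0"
  shows "integrable lborel (gauss_weight B)" "integrable lborel (\<lambda>s. s\<^sup>2 * gauss_weight B s)"
proof -
  have "integrable lborel (gauss_weight B)" if "B > 0" for B
  proof -
    have "(\<lambda>s. indicator {0<..} s *\<^sub>R (s powr (B - 1) * exp (- s\<^sup>2 / 2))) = gauss_weight B"
      by (auto simp: gauss_weight_def indicator_def)
    then show ?thesis
      using set_integrable_gauss_powr[of "B - 1"] that by (simp add: set_integrable_def)
  qed
  note * = this
  have "(\<lambda>s. s\<^sup>2 * gauss_weight B s) = gauss_weight (B + 2)"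
    using powr_add[of _ "B - 1" 2] by (auto simp: gauss_weight_def fun_eq_iff)
  then show "integrable lborel (gauss_weight B)" "integrable lborel (\<lambda>s. s\<^sup>2 * gauss_weight B s)"
    using *[of B] *[of "B + 2"] assms by auto
qed

text \<open>The integrand is the derivative of \<open>s powr B * exp (- s\<^sup>2 / 2)\<close>.
  One-sided limits stand in for endpoint values so that \<open>0\<close> and infinity are allowed as
  endpoints.\<close>

lemma gauss_weight_FTC:
  fixes a b :: ereal
  assumes "B > 0" "0 \<le> a" "a < b"
    and La: "(((\<lambda>s. s powr B * exp (- s\<^sup>2 / 2)) \<circ> real_of_ereal) \<longlongrightarrow> la) (at_right a)"
    and Lb: "(((\<lambda>s. s powr B * exp (- s\<^sup>2 / 2)) \<circ> real_of_ereal) \<longlongrightarrow> lb) (at_left b)"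
  shows "(LBINT s:einterval a b. B * gauss_weight B s - s\<^sup>2 * gauss_weight B s) = lb - la"
proof -
  have i: "set_integrable lborel (einterval a b) (\<lambda>s. B * gauss_weight B s - s\<^sup>2 * gauss_weight B s)"
    using integrable_gauss_weight[OF \<open>B > 0\<close>] unfolding set_integrable_def
    by (intro integrable_mult_indicator) auto
  have pos: "0 < x" if "a < ereal x" for x
    using that \<open>0 \<le> a\<close> by (metis ereal_less(2) le_less_trans)
  have "(LBINT s=a..b. B * gauss_weight B s - s\<^sup>2 * gauss_weight B s) = lb - la"
  proof (rule interval_integral_FTC_integrable[OF \<open>a < b\<close> _ _ i La Lb])
    fix x assume "a < ereal x" "ereal x < b"
    then have x: "0 < x" by (auto dest: pos)
    have "((\<lambda>s. s powr B * exp (- s\<^sup>2 / 2)) has_real_derivative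
        B * (x powr (B - 1) * exp (- x\<^sup>2 / 2)) - x * (x powr B * exp (- x\<^sup>2 / 2))) (at x)"
      using x by (auto intro!: derivative_eq_intros simp: algebra_simps powr_diff)
    also have "x * (x powr B * exp (- x\<^sup>2 / 2)) = x\<^sup>2 * gauss_weight B x"
      using x by (simp add: gauss_weight_def powr_diff power2_eq_square)
    finally show "((\<lambda>s. s powr B * exp (- s\<^sup>2 / 2)) has_vector_derivative B * gauss_weight B x - x\<^sup>2 * gauss_weight B x) (at x)"
      using x by (simp add: has_real_derivative_iff_has_vector_derivative gauss_weight_def)
    have "isCont (\<lambda>x. B * (x powr (B - 1) * exp (- x\<^sup>2 / 2)) - x\<^sup>2 * (x powr (B - 1) * exp (- x\<^sup>2 / 2))) x"
      using x by (intro continuous_intros) auto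
    moreover have "\<forall>\<^sub>F y in nhds x. B * gauss_weight B y - y\<^sup>2 * gauss_weight B y =
        B * (y powr (B - 1) * exp (- y\<^sup>2 / 2)) - y\<^sup>2 * (y powr (B - 1) * exp (- y\<^sup>2 / 2))"
      using x by (intro eventually_nhds_in_open[THEN eventually_mono, of "{0<..}"]) (auto simp: gauss_weight_def)
    ultimately show "isCont (\<lambda>s. B * gauss_weight B s - s\<^sup>2 * gauss_weight B s) x"
      using isCont_cong by fastforce
  qed
  then show ?thesis
    using \<open>a < b\<close> by (simp add: interval_lebesgue_integral_def less_imp_le)
qed

lemma gauss_weight_limits:
  fixes B :: real assumes "B > 0"
  shows "((\<lambda>s. s powr B * exp (- s\<^sup>2 / 2)) \<longlongrightarrow> 0) (at_right 0)"
    and "((\<lambda>s. s powr B * exp (- s\<^sup>2 / 2)) \<longlongrightarrow> 0) at_top"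
  using assms by real_asymp+

text \<open>The antiderivative vanishes at \<open>0\<close> and at infinity, and its value at
  \<open>t\<close> is \<open>t * gauss_weight B t\<close>. This boundary term therefore has opposite
  signs on the two sides of \<open>t\<close>.\<close>

lemma gauss_weight_set_integrals:
  assumes "B > 0" "t > 0"
  shows "(LBINT s:{t<..}. s\<^sup>2 * gauss_weight B s) = B * (LBINT s:{t<..}. gauss_weight B s) + t * gauss_weight B t"
    and "(LBINT s:{0<..<t}. s\<^sup>2 * gauss_weight B s) = B * (LBINT s:{0<..<t}. gauss_weight B s) - t * gauss_weight B t"
proof -
  have i: "set_integrable lborel S (gauss_weight B)" "set_integrable lborel S (\<lambda>s. s\<^sup>2 * gauss_weight B s)"
    if "S \<in> sets borel" for S
    using integrable_gauss_weight[OF \<open>B > 0\<close>] that unfolding set_integrable_def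
    by (auto intro!: integrable_mult_indicator simp del: real_scaleR_def)
  have t: "t powr B * exp (- t\<^sup>2 / 2) = t * gauss_weight B t"
    using assms by (simp add: gauss_weight_def powr_diff)
  have c: "isCont (\<lambda>s. s powr B * exp (- s\<^sup>2 / 2)) t"
    using assms by (intro continuous_intros) auto
  have lims: "((\<lambda>s. s powr B * exp (- s\<^sup>2 / 2)) \<longlongrightarrow> t * gauss_weight B t) (at_right t)"
    "((\<lambda>s. s powr B * exp (- s\<^sup>2 / 2)) \<longlongrightarrow> t * gauss_weight B t) (at_left t)"
    using c unfolding t[symmetric] isCont_def by (auto intro: filterlim_at_within_not_equal tendsto_within_subset)
  have "(LBINT s:{t<..}. B * gauss_weight B s - s\<^sup>2 * gauss_weight B s) = 0 - t * gauss_weight B t"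
    using gauss_weight_FTC[OF \<open>B > 0\<close>, of "ereal t" \<infinity> "t * gauss_weight B t" 0] assms gauss_weight_limits lims
    by (simp add: ereal_tendsto_simps)
  then show "(LBINT s:{t<..}. s\<^sup>2 * gauss_weight B s) = B * (LBINT s:{t<..}. gauss_weight B s) + t * gauss_weight B t"
    using i by simp
  have "(LBINT s:{0<..<t}. B * gauss_weight B s - s\<^sup>2 * gauss_weight B s) = t * gauss_weight B t - 0"
    using gauss_weight_FTC[OF \<open>B > 0\<close>, of "ereal 0" "ereal t" 0 "t * gauss_weight B t"] assms gauss_weight_limits lims
    by (simp add: ereal_tendsto_simps del: zero_ereal_def)
  then show "(LBINT s:{0<..<t}. s\<^sup>2 * gauss_weight B s) = B * (LBINT s:{0<..<t}. gauss_weight B s) - t * gauss_weight B t"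
    using i by simp
qed

lemma gauss_weight_integral_split:
  assumes "B > 0" "t > 0"
  shows "(\<integral>s. gauss_weight B s \<partial>lborel) = (LBINT s:{0<..<t}. gauss_weight B s) + (LBINT s:{t<..}. gauss_weight B s)"
    and "(\<integral>s. s\<^sup>2 * gauss_weight B s \<partial>lborel) =
      (LBINT s:{0<..<t}. s\<^sup>2 * gauss_weight B s) + (LBINT s:{t<..}. s\<^sup>2 * gauss_weight B s)"
proof -
  have "(\<integral>s. f s \<partial>lborel) = (LBINT s:{0<..<t}. f s) + (LBINT s:{t<..}. f s)"
    if f: "integrable lborel f" and z: "\<And>s. s \<le> 0 \<Longrightarrow> f s = 0" for f :: "real \<Rightarrow> real"
  proof -
    have [measurable]: "f \<in> borel_measurable borel"
      using f by (auto dest: borel_measurable_integrable)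
    have "(\<integral>s. f s \<partial>lborel) =
        (\<integral>s. indicator {0<..<t} s *\<^sub>R f s + indicator {t<..} s *\<^sub>R f s \<partial>lborel)"
    proof (rule integral_cong_AE)
      show "AE s in lborel. f s = indicator {0<..<t} s *\<^sub>R f s + indicator {t<..} s *\<^sub>R f s"
        using AE_lborel_singleton[of t]
        by eventually_elim (use z assms in \<open>auto simp: indicator_def not_less\<close>)
    qed measurable
    also have "\<dots> = (LBINT s:{0<..<t}. f s) + (LBINT s:{t<..}. f s)"
      unfolding set_lebesgue_integral_def
      by (intro Bochner_Integration.integral_add integrable_mult_indicator f) auto
    finally show ?thesis .
  qed
  from this[OF integrable_gauss_weight(1)[OF \<open>B > 0\<close>]] this[OF integrable_gauss_weight(2)[OF \<open>B > 0\<close>]]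
  show "(\<integral>s. gauss_weight B s \<partial>lborel) = (LBINT s:{0<..<t}. gauss_weight B s) + (LBINT s:{t<..}. gauss_weight B s)"
    and "(\<integral>s. s\<^sup>2 * gauss_weight B s \<partial>lborel) =
      (LBINT s:{0<..<t}. s\<^sup>2 * gauss_weight B s) + (LBINT s:{t<..}. s\<^sup>2 * gauss_weight B s)"
    by (simp_all add: gauss_weight_def)
qed

text \<open>Adding the contributions of both sides of a split point, here \<open>1\<close>, cancels
  the boundary terms.\<close>

lemma gauss_weight_second_moment:
  assumes "B > 0"
  shows "(\<integral>s. s\<^sup>2 * gauss_weight B s \<partial>lborel) = B * (\<integral>s. gauss_weight B s \<partial>lborel)"
  using gauss_weight_integral_split[OF assms, of 1] gauss_weight_set_integrals[OF assms, of 1]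
  by (simp add: algebra_simps)

text \<open>The integral over the product region is \<open>F * Pc - P * Fc\<close>, where
  \<open>F\<close>, \<open>P\<close> are the truncated moments below \<open>t\<close> and
  \<open>Fc\<close>, \<open>Pc\<close> those above. Inserting the formulas for \<open>P\<close> and
  \<open>Pc\<close>, the terms \<open>B * F * Fc\<close> cancel, and the boundary terms add up to
  \<open>t * gauss_weight B t * (F + Fc)\<close>.\<close>

lemma gauss_weight_kernel:
  assumes "B > 0" "t > 0"
  shows "(\<integral>\<^sup>+x. \<integral>\<^sup>+y. ennreal (indicator {t<..} x * indicator {0<..<t} y *
      ((x\<^sup>2 - y\<^sup>2) * gauss_weight B x * gauss_weight B y)) \<partial>lborel \<partial>lborel)
    = ennreal (t * gauss_weight B t * (\<integral>s. gauss_weight B s \<partial>lborel))"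
proof -
  define F P Fc Pc where "F = (LBINT s:{0<..<t}. gauss_weight B s)" and "P = (LBINT s:{0<..<t}. s\<^sup>2 * gauss_weight B s)"
    and "Fc = (LBINT s:{t<..}. gauss_weight B s)" and "Pc = (LBINT s:{t<..}. s\<^sup>2 * gauss_weight B s)"
  have i: "integrable lborel (\<lambda>s. indicator S s * gauss_weight B s)"
      "integrable lborel (\<lambda>s. indicator S s * (s\<^sup>2 * gauss_weight B s))"
    if "S \<in> sets borel" for S
    using integrable_gauss_weight[OF \<open>B > 0\<close>] that
      integrable_mult_indicator[of S lborel "gauss_weight B"] integrable_mult_indicator[of S lborel "\<lambda>s. s\<^sup>2 * gauss_weight B s"]
    by auto
  have "has_bochner_integral lborel
      (\<lambda>y. indicator {t<..} x * gauss_weight B x * (x\<^sup>2 * (indicator {0<..<t} y * gauss_weight B y)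
        - indicator {0<..<t} y * (y\<^sup>2 * gauss_weight B y)))
      (indicator {t<..} x * gauss_weight B x * (x\<^sup>2 * F - P))" for x
    unfolding F_def P_def set_lebesgue_integral_def real_scaleR_def
    by (intro has_bochner_integral_mult_right has_bochner_integral_diff has_bochner_integral_integrable i) auto
  then have inner: "has_bochner_integral lborel
      (\<lambda>y. indicator {t<..} x * indicator {0<..<t} y * ((x\<^sup>2 - y\<^sup>2) * gauss_weight B x * gauss_weight B y))
      (indicator {t<..} x * gauss_weight B x * (x\<^sup>2 * F - P))" for x
    by (rule has_bochner_integral_cong[THEN iffD1, rotated -1]) (auto simp: algebra_simps)
  have nn: "0 \<le> indicator {t<..} x * indicator {0<..<t} y * ((x\<^sup>2 - y\<^sup>2) * gauss_weight B x * gauss_weight B y)"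
    for x y :: real
    by (auto simp: indicator_def intro!: mult_nonneg_nonneg power_mono)
  have inner_nn: "(\<integral>\<^sup>+y. ennreal (indicator {t<..} x * indicator {0<..<t} y *
      ((x\<^sup>2 - y\<^sup>2) * gauss_weight B x * gauss_weight B y)) \<partial>lborel)
      = ennreal (indicator {t<..} x * gauss_weight B x * (x\<^sup>2 * F - P))" for x
    using inner[of x] nn by (subst nn_integral_eq_integral) (auto simp: has_bochner_integral_iff)
  have nn': "0 \<le> indicator {t<..} x * gauss_weight B x * (x\<^sup>2 * F - P)" for x
    unfolding has_bochner_integral_integral_eq[OF inner, symmetric]
    by (rule Bochner_Integration.integral_nonneg, rule nn)
  have "has_bochner_integral lborel
      (\<lambda>x. F * (indicator {t<..} x * (x\<^sup>2 * gauss_weight B x)) - P * (indicator {t<..} x * gauss_weight B x))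
      (F * Pc - P * Fc)"
    unfolding Fc_def Pc_def set_lebesgue_integral_def real_scaleR_def
    by (intro has_bochner_integral_mult_right has_bochner_integral_diff has_bochner_integral_integrable i) auto
  then have "has_bochner_integral lborel (\<lambda>x. indicator {t<..} x * gauss_weight B x * (x\<^sup>2 * F - P)) (F * Pc - P * Fc)"
    by (rule has_bochner_integral_cong[THEN iffD1, rotated -1]) (auto simp: algebra_simps)
  then have "(\<integral>\<^sup>+x. ennreal (indicator {t<..} x * gauss_weight B x * (x\<^sup>2 * F - P)) \<partial>lborel)
      = ennreal (F * Pc - P * Fc)"
    using nn' by (subst nn_integral_eq_integral) (auto simp: has_bochner_integral_iff)
  also have "F * Pc - P * Fc = t * gauss_weight B t * (F + Fc)"
    using gauss_weight_set_integrals[OF assms, folded F_def P_def Fc_def Pc_def]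
    by (simp only:) (simp add: algebra_simps)
  also have "F + Fc = (\<integral>s. gauss_weight B s \<partial>lborel)"
    using gauss_weight_integral_split[OF assms] by (simp add: F_def Fc_def)
  finally show ?thesis by (simp add: inner_nn)
qed

section \<open>The Poincare inequality\<close>

text \<open>With total mass \<open>Z\<close>, mean \<open>m\<close> and second moment
  \<open>S\<close>, both sides expand to \<open>2 * Z * (S - Z * m\<^sup>2)\<close>. A variance thus
  becomes a mean square of increments, and increments can be controlled by the derivative.\<close>

lemma (in finite_measure) double_integral_square_diff:
  fixes v :: "'a \<Rightarrow> real"
  assumes [measurable]: "v \<in> borel_measurable M"
    and fin: "(\<integral>\<^sup>+x. ennreal ((v x)\<^sup>2) \<partial>M) < \<infinity>"
  obtains m where "(\<integral>\<^sup>+x. \<integral>\<^sup>+y. ennreal ((v x - v y)\<^sup>2) \<partial>M \<partial>M)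
    = ennreal (2 * measure M (space M)) * (\<integral>\<^sup>+x. ennreal ((v x - m)\<^sup>2) \<partial>M)"
proof -
  define Z S where "Z = measure M (space M)" and "S = (\<integral>x. (v x)\<^sup>2 \<partial>M)"
  define m where "m = (\<integral>x. v x \<partial>M) / Z"
  have v2: "integrable M (\<lambda>x. (v x)\<^sup>2)"
    using fin by (intro integrableI_nonneg) auto
  have v: "integrable M v"
    by (rule square_integrable_imp_integrable[OF _ v2]) measurable
  have Zm: "(\<integral>x. v x \<partial>M) = Z * m"
  \<comment> \<open>For the zero measure \<open>m\<close> comes from a division by zero, so the
    identity needs a separate argument: every function is null almost everywhere.\<close>
  proof (cases "Z = 0")
    case True
    then have "emeasure M (space M) = 0" by (simp add: Z_def emeasure_eq_measure)
    then have "AE x in M. v x = 0"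
      by (rule emeasure_0_AE)
    then have "(\<integral>x. v x \<partial>M) = 0" by (simp add: integral_eq_zero_AE)
    then show ?thesis using True by simp
  qed (simp add: m_def)
  have one: "has_bochner_integral M (\<lambda>y. (c - v y)\<^sup>2) (c\<^sup>2 * Z - 2 * c * (Z * m) + S)" for c
  proof -
    have "has_bochner_integral M (\<lambda>y. c\<^sup>2 - 2 * c * v y + (v y)\<^sup>2) (c\<^sup>2 * Z - 2 * c * (Z * m) + S)"
      using v v2 by (simp add: has_bochner_integral_iff Zm Z_def S_def)
    then show ?thesis by (simp add: power2_eq_square algebra_simps)
  qed
  have inner: "(\<integral>\<^sup>+y. ennreal ((c - v y)\<^sup>2) \<partial>M) = ennreal (c\<^sup>2 * Z - 2 * c * (Z * m) + S)" for c
    using one[of c] by (subst nn_integral_eq_integral) (auto simp: has_bochner_integral_iff)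
  have nn: "0 \<le> c\<^sup>2 * Z - 2 * c * (Z * m) + S" for c
    using one[of c] Bochner_Integration.integral_nonneg[of M "\<lambda>y. (c - v y)\<^sup>2"] by (simp add: has_bochner_integral_iff)
  have "has_bochner_integral M (\<lambda>x. (v x)\<^sup>2 * Z - 2 * v x * (Z * m) + S) (S * Z - 2 * (Z * m) * (Z * m) + S * Z)"
    using v v2 by (simp add: has_bochner_integral_iff Zm Z_def S_def)
  then have "(\<integral>\<^sup>+x. \<integral>\<^sup>+y. ennreal ((v x - v y)\<^sup>2) \<partial>M \<partial>M) = ennreal (S * Z - 2 * (Z * m) * (Z * m) + S * Z)"
    unfolding inner by (subst nn_integral_eq_integral) (use nn in \<open>auto simp: has_bochner_integral_iff\<close>)
  also have "S * Z - 2 * (Z * m) * (Z * m) + S * Z = (2 * Z) * (m\<^sup>2 * Z - 2 * m * (Z * m) + S)"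
    by (simp add: power2_eq_square algebra_simps)
  also have "ennreal \<dots> = ennreal (2 * Z) * (\<integral>\<^sup>+y. ennreal ((m - v y)\<^sup>2) \<partial>M)"
    unfolding inner by (rule ennreal_mult) (use nn in \<open>auto simp: Z_def\<close>)
  also have "(\<integral>\<^sup>+y. ennreal ((m - v y)\<^sup>2) \<partial>M) = (\<integral>\<^sup>+y. ennreal ((v y - m)\<^sup>2) \<partial>M)"
    by (simp add: power2_commute)
  finally show thesis unfolding Z_def by (rule that)
qed

text \<open>Cauchy--Schwarz for the factorization of \<open>\<bar>h t\<bar>\<close> into
  \<open>\<bar>h t\<bar> / sqrt (2 * t)\<close> and \<open>sqrt (2 * t)\<close>. The square of the
  second factor integrates to \<open>x\<^sup>2 - y\<^sup>2\<close>.\<close>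

lemma indef_int_square_diff_le:
  assumes v: "indef_int v h" and h [measurable]: "h \<in> borel_measurable borel" and xy: "0 < y" "y < x"
  shows "ennreal ((v x - v y)\<^sup>2) \<le>
    (\<integral>\<^sup>+t. indicator {y<..<x} t * ennreal ((h t)\<^sup>2 / (2 * t)) \<partial>lborel) * ennreal (x\<^sup>2 - y\<^sup>2)"
proof -
  note D = indef_intD[OF v, of y x]
  have "v x - v y = (\<integral>t. indicator {y..x} t * h t \<partial>lborel)"
    using D xy by (simp add: set_lebesgue_integral_def)
  also have "ennreal \<bar>\<dots>\<bar> \<le> (\<integral>\<^sup>+t. ennreal \<bar>indicator {y..x} t * h t\<bar> \<partial>lborel)"
    using D(1) xy integral_norm_bound_ennreal[of lborel "\<lambda>t. indicator {y..x} t * h t"]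
    by (simp add: set_integrable_def)
  \<comment> \<open>The open interval matches the strict inequalities \<open>y < t\<close> and
    \<open>t < x\<close> of the kernel; its endpoints are null.\<close>
  also have "\<dots> = (\<integral>\<^sup>+t. (indicator {y<..<x} t * ennreal (\<bar>h t\<bar> / sqrt (2 * t))) *
      (indicator {y<..<x} t * ennreal (sqrt (2 * t))) \<partial>lborel)"
  proof (rule nn_integral_cong_AE)
    show "AE t in lborel. ennreal \<bar>indicator {y..x} t * h t\<bar> =
      (indicator {y<..<x} t * ennreal (\<bar>h t\<bar> / sqrt (2 * t))) * (indicator {y<..<x} t * ennreal (sqrt (2 * t)))"
      using AE_lborel_singleton[of x] AE_lborel_singleton[of y]
    proof eventually_elim
      case (elim t)
      then show ?case
        using xy by (cases "t \<in> {y<..<x}") (auto simp: indicator_def ennreal_mult[symmetric])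
    qed
  qed
  finally have "(ennreal \<bar>v x - v y\<bar>)\<^sup>2 \<le> \<dots>\<^sup>2"
    by (rule power_mono) simp
  also have "\<dots> \<le> (\<integral>\<^sup>+t. (indicator {y<..<x} t * ennreal (\<bar>h t\<bar> / sqrt (2 * t)))\<^sup>2 \<partial>lborel) *
      (\<integral>\<^sup>+t. (indicator {y<..<x} t * ennreal (sqrt (2 * t)))\<^sup>2 \<partial>lborel)"
    by (rule Cauchy_Schwarz_nn_integral) measurable
  also have "(\<lambda>t. (indicator {y<..<x} t * ennreal (\<bar>h t\<bar> / sqrt (2 * t)))\<^sup>2) =
      (\<lambda>t. indicator {y<..<x} t * ennreal ((h t)\<^sup>2 / (2 * t)))"
    using xy by (auto simp: fun_eq_iff indicator_def ennreal_power power_divide)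
  also have "(\<integral>\<^sup>+t. (indicator {y<..<x} t * ennreal (sqrt (2 * t)))\<^sup>2 \<partial>lborel) =
      (\<integral>\<^sup>+t. ennreal (2 * t) * indicator {y..x} t \<partial>lborel)"
  proof (rule nn_integral_cong_AE)
    show "AE t in lborel. (indicator {y<..<x} t * ennreal (sqrt (2 * t)))\<^sup>2 = ennreal (2 * t) * indicator {y..x} t"
      using AE_lborel_singleton[of x] AE_lborel_singleton[of y]
      by eventually_elim (use xy in \<open>auto simp: indicator_def ennreal_power\<close>)
  qed
  also have "\<dots> = ennreal (x\<^sup>2 - y\<^sup>2)"
    using xy by (intro nn_integral_FTC_Icc) (auto intro!: derivative_eq_intros)
  also have "(ennreal \<bar>v x - v y\<bar>)\<^sup>2 = ennreal ((v x - v y)\<^sup>2)"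
    by (simp add: ennreal_power)
  finally show ?thesis .
qed

text \<open>Each squared increment is bounded, \<open>t\<close> is made the outermost variable, and
  the kernel identity evaluates the rest. The factor one half is what is left of
  \<open>1 / (2 * t)\<close> once the kernel has supplied \<open>t\<close>.\<close>

lemma gauss_weight_double_integral_le:
  assumes B: "B > 0" and v: "indef_int v h"
    and [measurable]: "h \<in> borel_measurable borel" "v \<in> borel_measurable borel"
  shows "(\<integral>\<^sup>+x. \<integral>\<^sup>+y. ennreal (if y < x then (v x - v y)\<^sup>2 * gauss_weight B x * gauss_weight B y else 0) \<partial>lborel \<partial>lborel)
    \<le> ennreal ((\<integral>s. gauss_weight B s \<partial>lborel) / 2) * (\<integral>\<^sup>+t. ennreal ((h t)\<^sup>2 * gauss_weight B t) \<partial>lborel)"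
proof -
  define Z where "Z = (\<integral>s. gauss_weight B s \<partial>lborel)"
  have Z: "0 \<le> Z" by (simp add: Z_def)
  define K where "K = (\<lambda>x y t. (indicator {t<..} x * indicator {0<..<t} y * ((x\<^sup>2 - y\<^sup>2) * gauss_weight B x * gauss_weight B y)) :: real)"
  have K0: "0 \<le> K x y t" for x y t
    unfolding K_def by (auto simp: indicator_def intro!: mult_nonneg_nonneg power_mono)
  define \<Phi> where "\<Phi> = (\<lambda>x y t. ennreal ((h t)\<^sup>2 / (2 * t)) * ennreal (K x y t))"
  \<comment> \<open>Written with a predicate instead of indicators of sets depending on
    \<open>t\<close>, the region is visibly measurable jointly in \<open>x\<close>, \<open>y\<close>
    and \<open>t\<close>, as the exchanges of integrals require.\<close>
  have \<Phi>_eq: "\<Phi> = (\<lambda>x y t. ennreal ((h t)\<^sup>2 / (2 * t)) * ennreal (if t < x \<and> 0 < y \<and> y < t then (x\<^sup>2 - y\<^sup>2) * gauss_weight B x * gauss_weight B y else 0))"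
    unfolding \<Phi>_def K_def by (intro ext) (auto simp: indicator_def)
  have [measurable (raw)]: "(\<lambda>s. \<Phi> (f s) (g s) (k s)) \<in> borel_measurable M"
    if [measurable]: "f \<in> borel_measurable M" "g \<in> borel_measurable M" "k \<in> borel_measurable M"
    for f g k and M :: "'m measure"
    unfolding \<Phi>_eq by measurable
  have le: "ennreal (if y < x then (v x - v y)\<^sup>2 * gauss_weight B x * gauss_weight B y else 0) \<le> (\<integral>\<^sup>+t. \<Phi> x y t \<partial>lborel)" for x y
  proof (cases "0 < y \<and> y < x")
    case True
    have "ennreal (if y < x then (v x - v y)\<^sup>2 * gauss_weight B x * gauss_weight B y else 0)
        = ennreal ((v x - v y)\<^sup>2) * ennreal (gauss_weight B x * gauss_weight B y)"
      using True by (simp add: ennreal_mult[symmetric] mult.assoc)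
    also have "\<dots> \<le> (\<integral>\<^sup>+t. indicator {y<..<x} t * ennreal ((h t)\<^sup>2 / (2 * t)) \<partial>lborel) * ennreal (x\<^sup>2 - y\<^sup>2) * ennreal (gauss_weight B x * gauss_weight B y)"
      using True by (intro mult_right_mono indef_int_square_diff_le[OF v]) auto
    also have "\<dots> = (\<integral>\<^sup>+t. ennreal ((x\<^sup>2 - y\<^sup>2) * gauss_weight B x * gauss_weight B y) * (indicator {y<..<x} t * ennreal ((h t)\<^sup>2 / (2 * t))) \<partial>lborel)"
    proof -
      have "ennreal ((x\<^sup>2 - y\<^sup>2) * gauss_weight B x * gauss_weight B y) = ennreal (x\<^sup>2 - y\<^sup>2) * ennreal (gauss_weight B x * gauss_weight B y)"
        using True by (simp add: ennreal_mult[symmetric] mult.assoc power_mono)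
      then show ?thesis by (subst nn_integral_cmult) (measurable, simp add: mult_ac)
    qed
    also have "\<dots> = (\<integral>\<^sup>+t. \<Phi> x y t \<partial>lborel)"
      using True by (intro nn_integral_cong) (auto simp: \<Phi>_eq indicator_def mult_ac)
    finally show ?thesis .
  qed (auto simp: gauss_weight_def)
  have "(\<integral>\<^sup>+x. \<integral>\<^sup>+y. ennreal (if y < x then (v x - v y)\<^sup>2 * gauss_weight B x * gauss_weight B y else 0) \<partial>lborel \<partial>lborel)
      \<le> (\<integral>\<^sup>+x. \<integral>\<^sup>+y. \<integral>\<^sup>+t. \<Phi> x y t \<partial>lborel \<partial>lborel \<partial>lborel)"
    by (intro nn_integral_mono le)
  \<comment> \<open>Tonelli twice: first \<open>y\<close> and \<open>t\<close> are swapped for fixed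
    \<open>x\<close>, then \<open>x\<close> and \<open>t\<close>.\<close>
  also have "\<dots> = (\<integral>\<^sup>+x. \<integral>\<^sup>+t. \<integral>\<^sup>+y. \<Phi> x y t \<partial>lborel \<partial>lborel \<partial>lborel)"
    by (intro nn_integral_cong lborel_pair.Fubini'[symmetric]) measurable
  also have "\<dots> = (\<integral>\<^sup>+t. \<integral>\<^sup>+x. \<integral>\<^sup>+y. \<Phi> x y t \<partial>lborel \<partial>lborel \<partial>lborel)"
    by (rule lborel_pair.Fubini'[symmetric]) measurable
  also have "\<dots> = (\<integral>\<^sup>+t. ennreal (Z / 2) * ennreal ((h t)\<^sup>2 * gauss_weight B t) \<partial>lborel)"
  proof (rule nn_integral_cong)
    fix t :: real
    have [measurable]: "(\<lambda>y. K x y t) \<in> borel_measurable borel" for x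
      unfolding K_def by measurable
    have "(\<lambda>(x, y). ennreal (K x y t)) \<in> borel_measurable (borel \<Otimes>\<^sub>M borel)"
      unfolding K_def by measurable
    then have [measurable]: "(\<lambda>x. \<integral>\<^sup>+y. ennreal (K x y t) \<partial>lborel) \<in> borel_measurable borel"
      by measurable
    have "(\<integral>\<^sup>+x. \<integral>\<^sup>+y. \<Phi> x y t \<partial>lborel \<partial>lborel) =
        ennreal ((h t)\<^sup>2 / (2 * t)) * (\<integral>\<^sup>+x. \<integral>\<^sup>+y. ennreal (K x y t) \<partial>lborel \<partial>lborel)"
      unfolding \<Phi>_def by (simp add: nn_integral_cmult)
    also have "\<dots> = ennreal (Z / 2) * ennreal ((h t)\<^sup>2 * gauss_weight B t)"
    proof (cases "0 < t")
      case True
      then show ?thesis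
        unfolding K_def gauss_weight_kernel[OF B True] using Z
        by (simp add: Z_def[symmetric] ennreal_mult[symmetric] mult_ac)
    next
      case False
      \<comment> \<open>For \<open>t < 0\<close> the quotient is at most zero and
        \<open>ennreal\<close> truncates it; at \<open>t = 0\<close> it is zero by the convention
        for division.\<close>
      then have "ennreal ((h t)\<^sup>2 / (2 * t)) = 0" by (intro ennreal_neg divide_nonneg_nonpos) auto
      then show ?thesis using False by (simp add: gauss_weight_def)
    qed
    finally show "(\<integral>\<^sup>+x. \<integral>\<^sup>+y. \<Phi> x y t \<partial>lborel \<partial>lborel) = ennreal (Z / 2) * ennreal ((h t)\<^sup>2 * gauss_weight B t)" .
  qed
  also have "\<dots> = ennreal (Z / 2) * (\<integral>\<^sup>+t. ennreal ((h t)\<^sup>2 * gauss_weight B t) \<partial>lborel)"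
    by (rule nn_integral_cmult) measurable
  finally show ?thesis unfolding Z_def .
qed

text \<open>The double integral over all pairs is twice the one over \<open>y < x\<close>. It equals
  \<open>2 * Z\<close> times the integral of \<open>(v - m)\<^sup>2\<close>, with \<open>m\<close>
  the mean of \<open>v\<close>, and is at most \<open>Z\<close> times the integral of
  \<open>h\<^sup>2\<close>. Cancelling \<open>Z\<close> leaves the constant
  \<open>2\<close>.\<close>

lemma gauss_weight_Poincare:
  assumes B: "B > 0" and v: "indef_int v h"
    and [measurable]: "h \<in> borel_measurable borel" "v \<in> borel_measurable borel"
    and fin: "(\<integral>\<^sup>+s. ennreal ((v s)\<^sup>2 * gauss_weight B s) \<partial>lborel) < \<infinity>"
  obtains m where "2 * (\<integral>\<^sup>+s. ennreal ((v s - m)\<^sup>2 * gauss_weight B s) \<partial>lborel)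
    \<le> (\<integral>\<^sup>+t. ennreal ((h t)\<^sup>2 * gauss_weight B t) \<partial>lborel)"
proof -
  define Z where "Z = (\<integral>s. gauss_weight B s \<partial>lborel)"
  define N where "N = density lborel (\<lambda>s. ennreal (gauss_weight B s))"
  have eN: "emeasure N (space N) = ennreal Z"
    using integrable_gauss_weight(1)[OF B] by (simp add: N_def Z_def emeasure_density nn_integral_eq_integral)
  interpret N: finite_measure N
    by standard (simp add: eN)
  have Nint: "(\<integral>\<^sup>+s. ennreal (f s) \<partial>N) = (\<integral>\<^sup>+s. ennreal (f s * gauss_weight B s) \<partial>lborel)"
    if [measurable]: "f \<in> borel_measurable borel" and "\<And>s. 0 \<le> f s" for f
    unfolding N_def using that(2) by (subst nn_integral_density) (auto simp: ennreal_mult mult.commute)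
  \<comment> \<open>Strict positivity allows the final cancellation. Otherwise the weight would
    vanish almost everywhere on an interval of length one.\<close>
  have Z: "0 < Z"
  proof (rule ccontr)
    assume "\<not> 0 < Z"
    moreover have "0 \<le> Z" by (simp add: Z_def)
    ultimately have "Z = 0" by linarith
    then have "(\<integral>\<^sup>+s. ennreal (gauss_weight B s) \<partial>lborel) = 0"
      using integrable_gauss_weight(1)[OF B] by (simp add: Z_def nn_integral_eq_integral)
    then have "AE s in lborel. gauss_weight B s = 0"
      by (subst (asm) nn_integral_0_iff_AE) (auto simp: order_antisym_conv)
    then have "AE s in lborel. s \<notin> {0<..<1::real}"
      by eventually_elim (auto simp: gauss_weight_def)
    then have "emeasure lborel {0<..<1::real} = 0"
      by (subst (asm) AE_iff_measurable[of "{0<..<1}"]) auto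
    then show False by simp
  qed
  have "v \<in> borel_measurable N" by (simp add: N_def)
  moreover have "(\<integral>\<^sup>+x. ennreal ((v x)\<^sup>2) \<partial>N) < \<infinity>"
    using fin by (subst Nint) auto
  ultimately obtain m where m: "(\<integral>\<^sup>+x. \<integral>\<^sup>+y. ennreal ((v x - v y)\<^sup>2) \<partial>N \<partial>N)
    = ennreal (2 * measure N (space N)) * (\<integral>\<^sup>+x. ennreal ((v x - m)\<^sup>2) \<partial>N)"
    by (rule N.double_integral_square_diff)
  define U where "U = (\<lambda>x y. ennreal (if y < x then (v x - v y)\<^sup>2 * gauss_weight B x * gauss_weight B y else 0))"
  have [measurable]: "(\<lambda>(x, y). U x y) \<in> borel_measurable (borel \<Otimes>\<^sub>M borel)"
    unfolding U_def by measurable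
  \<comment> \<open>The diagonal lies in neither of the two halves, but the squared increment is
    zero there.\<close>
  have U: "(\<integral>\<^sup>+y. ennreal ((v x - v y)\<^sup>2) \<partial>N) * ennreal (gauss_weight B x)
      = (\<integral>\<^sup>+y. U x y \<partial>lborel) + (\<integral>\<^sup>+y. U y x \<partial>lborel)" for x
  proof -
    have "(\<integral>\<^sup>+y. ennreal ((v x - v y)\<^sup>2) \<partial>N) * ennreal (gauss_weight B x)
        = (\<integral>\<^sup>+y. ennreal ((v x - v y)\<^sup>2 * gauss_weight B y) * ennreal (gauss_weight B x) \<partial>lborel)"
      by (subst Nint) (auto intro!: nn_integral_multc[symmetric])
    also have "\<dots> = (\<integral>\<^sup>+y. U x y + U y x \<partial>lborel)"
      by (intro nn_integral_cong)
         (auto simp: U_def ennreal_mult[symmetric] mult_ac power2_commute[of "v x"])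
    also have "\<dots> = (\<integral>\<^sup>+y. U x y \<partial>lborel) + (\<integral>\<^sup>+y. U y x \<partial>lborel)"
      by (rule nn_integral_add) measurable
    finally show ?thesis .
  qed
  have "ennreal (2 * Z) * (\<integral>\<^sup>+x. ennreal ((v x - m)\<^sup>2) \<partial>N)
      = (\<integral>\<^sup>+x. \<integral>\<^sup>+y. ennreal ((v x - v y)\<^sup>2) \<partial>N \<partial>N)"
    using eN Z by (simp add: m measure_def)
  also have "\<dots> = (\<integral>\<^sup>+x. (\<integral>\<^sup>+y. ennreal ((v x - v y)\<^sup>2) \<partial>N) * ennreal (gauss_weight B x) \<partial>lborel)"
  proof -
    define Q where "Q = (\<lambda>x. \<integral>\<^sup>+y. ennreal ((v x - v y)\<^sup>2) \<partial>N)"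
    have [measurable]: "Q \<in> borel_measurable borel"
      unfolding Q_def by (rule N.borel_measurable_nn_integral) (simp add: N_def)
    have "(\<integral>\<^sup>+x. Q x \<partial>N) = (\<integral>\<^sup>+x. Q x * ennreal (gauss_weight B x) \<partial>lborel)"
      unfolding N_def by (subst nn_integral_density) (auto simp: mult.commute)
    then show ?thesis unfolding Q_def .
  qed
  also have "\<dots> = (\<integral>\<^sup>+x. (\<integral>\<^sup>+y. U x y \<partial>lborel) \<partial>lborel) + (\<integral>\<^sup>+x. (\<integral>\<^sup>+y. U y x \<partial>lborel) \<partial>lborel)"
    unfolding U by (rule nn_integral_add) measurable
  also have "(\<integral>\<^sup>+x. (\<integral>\<^sup>+y. U y x \<partial>lborel) \<partial>lborel) = (\<integral>\<^sup>+x. (\<integral>\<^sup>+y. U x y \<partial>lborel) \<partial>lborel)"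
    by (rule lborel_pair.Fubini') measurable
  also have "(\<integral>\<^sup>+x. (\<integral>\<^sup>+y. U x y \<partial>lborel) \<partial>lborel) + (\<integral>\<^sup>+x. (\<integral>\<^sup>+y. U x y \<partial>lborel) \<partial>lborel)
      = 2 * (\<integral>\<^sup>+x. (\<integral>\<^sup>+y. U x y \<partial>lborel) \<partial>lborel)"
    by (simp add: mult_2)
  also have "\<dots> \<le> 2 * (ennreal (Z / 2) * (\<integral>\<^sup>+t. ennreal ((h t)\<^sup>2 * gauss_weight B t) \<partial>lborel))"
    unfolding U_def Z_def by (intro mult_left_mono gauss_weight_double_integral_le[OF B v]) auto
  also have "\<dots> = ennreal Z * (\<integral>\<^sup>+t. ennreal ((h t)\<^sup>2 * gauss_weight B t) \<partial>lborel)"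
    using Z by (simp add: mult.assoc[symmetric] ennreal_mult[of 2 "Z / 2", symmetric] flip: ennreal_numeral)
  finally have *: "ennreal Z * (2 * (\<integral>\<^sup>+x. ennreal ((v x - m)\<^sup>2) \<partial>N)) \<le> ennreal Z * (\<integral>\<^sup>+t. ennreal ((h t)\<^sup>2 * gauss_weight B t) \<partial>lborel)"
    using Z by (simp add: ennreal_mult mult_ac)
  have "2 * (\<integral>\<^sup>+x. ennreal ((v x - m)\<^sup>2) \<partial>N) \<le> (\<integral>\<^sup>+t. ennreal ((h t)\<^sup>2 * gauss_weight B t) \<partial>lborel)"
    using * Z by (simp add: ennreal_mult_le_mult_iff)
  then show thesis
    by (intro that[of m]) (subst (asm) Nint, auto)
qed

section \<open>The critical exponent and admissible functions of finite energy\<close>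

lemma crit_exp_pos: "C > 0 \<Longrightarrow> crit_exp A C > 0"
proof -
  assume "C > 0"
  then have "\<bar>A - 2\<bar> < sqrt ((A - 2)\<^sup>2 + 4 * C)"
    by (intro real_less_rsqrt) auto
  then show ?thesis by (simp add: crit_exp_def)
qed

text \<open>This quadratic equation is what makes the coefficients of \<open>w\<^sup>2\<close> agree
  in the ground state expansion.\<close>

lemma crit_exp_root: "C > 0 \<Longrightarrow> (crit_exp A C)\<^sup>2 + (A - 2) * crit_exp A C = C"
proof -
  assume "C > 0"
  then have "(sqrt ((A - 2)\<^sup>2 + 4 * C))\<^sup>2 = (A - 2)\<^sup>2 + 4 * C"
    by (intro real_sqrt_pow2) simp
  then show ?thesis
    by (simp add: crit_exp_def power2_eq_square field_simps)
qed

text \<open>On the half-line \<open>deriv w\<close> is the pointwise limit of its truncations to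
  compact intervals. Each truncation is Lebesgue measurable because it comes from a
  Henstock--Kurzweil integrable function. A Borel function agrees with the limit almost everywhere,
  and the integral does not see the null set.\<close>

lemma admissible_borel_derivative:
  assumes "admissible w"
  obtains g where "g \<in> borel_measurable borel" "AE s in lborel. 0 < s \<longrightarrow> deriv w s = g s"
    "\<And>a b. 0 < a \<Longrightarrow> a \<le> b \<Longrightarrow> (g has_integral (w b - w a)) {a..b}"
proof -
  have int: "(deriv w has_integral (w b - w a)) {a..b}" if "0 < a" "a \<le> b" for a b
    using assms that unfolding admissible_def by blast
  define f where "f = (\<lambda>n s. if s \<in> {1 / real (Suc n)..real (Suc n)} then deriv w s else 0)"
  have "(\<lambda>s. if 0 < s then deriv w s else 0) \<in> borel_measurable lebesgue"
  proof (rule borel_measurable_LIMSEQ_real)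
    fix n
    have "1 / real (Suc n) \<le> real (Suc n)" by (simp add: field_simps)
    then have "deriv w integrable_on {1 / real (Suc n)..real (Suc n)}"
      using int[of "1 / real (Suc n)" "real (Suc n)"] by (auto simp: integrable_on_def)
    then show "f n \<in> borel_measurable lebesgue"
      unfolding f_def by (intro borel_measurable_if_I integrable_imp_measurable) auto
  next
    fix s :: real
    show "(\<lambda>n. f n s) \<longlonglongrightarrow> (if 0 < s then deriv w s else 0)"
    proof (cases "0 < s")
      case True
      have "\<forall>\<^sub>F n in sequentially. 1 / real (Suc n) \<le> s \<and> s \<le> real (Suc n)"
        using True by (intro eventually_conj) real_asymp+
      then have "\<forall>\<^sub>F n in sequentially. f n s = (if 0 < s then deriv w s else 0)"
        by eventually_elim (use True in \<open>auto simp: f_def\<close>)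
      then show ?thesis by (rule tendsto_eventually)
    next
      case False
      moreover have "0 < 1 / real (Suc n)" for n by simp
      ultimately have "f n s = 0" for n
        unfolding f_def by (metis atLeastAtMost_iff less_le_trans)
      then show ?thesis using False by simp
    qed
  qed
  then obtain g where g: "g \<in> borel_measurable lborel"
      "AE s in lborel. (if 0 < s then deriv w s else 0) = g s"
    using completion_ex_borel_measurable_real by blast
  have ae: "AE s in lborel. 0 < s \<longrightarrow> deriv w s = g s"
    using g(2) by eventually_elim auto
  show thesis
  proof (rule that)
    fix a b :: real assume ab: "0 < a" "a \<le> b"
    have "AE s in lborel. s \<in> {a..b} \<longrightarrow> deriv w s = g s"
      using ae by eventually_elim (use ab in auto)
    then show "(g has_integral (w b - w a)) {a..b}"
      using int[OF ab] by (simp add: has_integral_AE)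
  qed (use g ae in auto)
qed

text \<open>The weight is bounded below on \<open>{a..b}\<close>, so \<open>g\<close> is square integrable there.\<close>

lemma indef_int_of_finite_energy:
  assumes w: "\<And>a b. 0 < a \<Longrightarrow> a \<le> b \<Longrightarrow> (g has_integral (w b - w a)) {a..b}"
    and [measurable]: "g \<in> borel_measurable borel"
    and fin: "(\<integral>\<^sup>+s. ennreal ((g s)\<^sup>2 * gauss_weight A s) \<partial>lborel) < \<infinity>"
  shows "indef_int w g"
  unfolding indef_int_def
proof (intro allI impI)
  fix a b :: real assume ab: "0 < a" "a \<le> b"
  have "continuous_on {a..b} (\<lambda>s. s powr (A - 1) * exp (- s\<^sup>2 / 2))"
    using ab by (intro continuous_intros) auto
  then obtain z where z: "z \<in> {a..b}"
      "\<And>s. s \<in> {a..b} \<Longrightarrow> z powr (A - 1) * exp (- z\<^sup>2 / 2) \<le> s powr (A - 1) * exp (- s\<^sup>2 / 2)"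
    using continuous_attains_inf[of "{a..b}" "\<lambda>s. s powr (A - 1) * exp (- s\<^sup>2 / 2)"] ab by auto
  define c where "c = gauss_weight A z"
  have c: "0 < c" "\<And>s. s \<in> {a..b} \<Longrightarrow> c \<le> gauss_weight A s"
    using z ab by (auto simp: c_def gauss_weight_def)
  have i1: "integrable lborel (\<lambda>s. (g s)\<^sup>2 * gauss_weight A s)"
    using fin by (intro integrableI_nonneg) auto
  have i2: "integrable lborel (indicat_real {a..b})"
    by (rule integrable_real_indicator) (auto simp: emeasure_lborel_Icc_eq)
  have s: "set_integrable lborel {a..b} g"
    unfolding set_integrable_def
  proof (rule Bochner_Integration.integrable_bound)
    \<comment> \<open>The majorant comes from \<open>\<bar>g s\<bar> \<le> (g s)\<^sup>2 + 1\<close>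
      and the lower bound \<open>c\<close> for the weight.\<close>
    show "integrable lborel (\<lambda>s. (1 / c) * ((g s)\<^sup>2 * gauss_weight A s) + indicator {a..b} s)"
      using i1 i2 by (intro Bochner_Integration.integrable_add integrable_mult_right)
    show "AE s in lborel. norm (indicator {a..b} s *\<^sub>R g s)
        \<le> norm ((1 / c) * ((g s)\<^sup>2 * gauss_weight A s) + indicator {a..b} s)"
    proof (intro AE_I2)
      fix s
      show "norm (indicator {a..b} s *\<^sub>R g s) \<le> norm ((1 / c) * ((g s)\<^sup>2 * gauss_weight A s) + indicator {a..b} s)"
      proof (cases "s \<in> {a..b}")
        case True
        have "0 \<le> (\<bar>g s\<bar> - 1)\<^sup>2 + 1" by simp
        then have "2 * \<bar>g s\<bar> \<le> (g s)\<^sup>2 + 2" by (simp add: power2_eq_square algebra_simps)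
        moreover have "0 \<le> (\<bar>g s\<bar> - 1)\<^sup>2" by simp
        then have "2 * \<bar>g s\<bar> \<le> (g s)\<^sup>2 + 1" by (simp add: power2_eq_square algebra_simps)
        moreover have "0 \<le> (g s)\<^sup>2" by simp
        ultimately have "\<bar>g s\<bar> \<le> (g s)\<^sup>2 * 1 + 1" by linarith
        also have "(g s)\<^sup>2 * 1 \<le> (g s)\<^sup>2 * (gauss_weight A s / c)"
          using c True by (intro mult_left_mono) auto
        finally show ?thesis using True c by simp
      qed simp
    qed
  qed measurable
  then show "set_integrable lborel {a..b} g \<and> (LBINT s:{a..b}. g s) = w b - w a"
    using set_borel_integral_eq_integral[OF s] integral_unique[OF w[OF ab]] by simp
qed

text \<open>Otherwise \<open>e\<close> would dominate a multiple of \<open>1 / s\<close> near \<open>0\<close>.\<close>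

lemma small_boundary_values:
  fixes G e :: "real \<Rightarrow> real"
  assumes "integrable lborel e" "\<And>s. 0 \<le> e s" and "C > 0"
    and le: "\<And>s. 0 < s \<Longrightarrow> C * G s / s \<le> e s" and "\<epsilon> > 0" "\<delta> > 0"
  obtains a where "0 < a" "a < \<delta>" "G a < \<epsilon>"
proof (rule ccontr)
  note witness = that
  assume "\<not> thesis"
  then have G: "\<epsilon> \<le> G a" if "0 < a" "a < \<delta>" for a
    using witness[of a] that by linarith
  define I where "I = (\<integral>s. e s \<partial>lborel)"
  have I: "0 \<le> I" using assms by (simp add: I_def)
  define d where "d = \<delta> / 2"
  \<comment> \<open>Chosen so that
    \<open>C * \<epsilon> * (ln d - ln x) = I + C * \<epsilon>\<close>, which exceeds the total
    integral \<open>I\<close>.\<close>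
  define x where "x = d * exp (- (I / (C * \<epsilon>) + 1))"
  have d: "0 < d" "d < \<delta>" using \<open>\<delta> > 0\<close> by (auto simp: d_def)
  have x: "0 < x" "x \<le> d"
  proof -
    have "0 \<le> I / (C * \<epsilon>)" using I assms by simp
    then show "0 < x" "x \<le> d" using d by (auto simp: x_def mult_le_cancel_left1)
  qed
  have "has_bochner_integral lborel (\<lambda>s. (C * \<epsilon> / s) * indicator {x..d} s) (C * \<epsilon> * ln d - C * \<epsilon> * ln x)"
    using x by (intro has_bochner_integral_FTC_Icc_real) (auto intro!: derivative_eq_intros continuous_intros)
  then have i: "integrable lborel (\<lambda>s. (C * \<epsilon> / s) * indicator {x..d} s)"
    and eq: "(\<integral>s. (C * \<epsilon> / s) * indicator {x..d} s \<partial>lborel) = C * \<epsilon> * ln d - C * \<epsilon> * ln x"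
    by (auto simp: has_bochner_integral_iff)
  have "C * \<epsilon> * ln d - C * \<epsilon> * ln x \<le> I"
    unfolding eq[symmetric] I_def
  proof (rule integral_mono[OF i \<open>integrable lborel e\<close>])
    fix s
    show "(C * \<epsilon> / s) * indicator {x..d} s \<le> e s"
    proof (cases "s \<in> {x..d}")
      case True
      then have s: "0 < s" "s < \<delta>" using x d by auto
      have "C * \<epsilon> / s \<le> C * G s / s"
        using s G[OF s] \<open>C > 0\<close> by (intro divide_right_mono mult_left_mono) auto
      then show ?thesis using le[OF s(1)] True by simp
    qed (use assms in auto)
  qed
  moreover have "ln x = ln d - (I / (C * \<epsilon>) + 1)"
    using d by (simp add: x_def ln_mult)
  ultimately have "C * \<epsilon> * (I / (C * \<epsilon>) + 1) \<le> I"
    by (simp add: algebra_simps)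
  moreover have "C * \<epsilon> * (I / (C * \<epsilon>) + 1) = I + C * \<epsilon>"
    using assms by (simp add: distrib_left)
  moreover have "0 < C * \<epsilon>" using assms by simp
  ultimately show False by linarith
qed

section \<open>The ground state substitution\<close>

text \<open>Finite energy makes \<open>g\<close> locally integrable, so the product rule applies to
  \<open>v\<close> and to \<open>G\<close>; it also supplies points near \<open>0\<close> where
  \<open>G\<close> is small. The result is an inequality because the boundary value of
  \<open>G\<close> at the right endpoint is discarded.\<close>

lemma energy_decomposition:
  fixes w g :: "real \<Rightarrow> real" and A C q :: real
  defines "v \<equiv> \<lambda>s. w s * s powr (- q)"
    and "h \<equiv> \<lambda>s. g s * s powr (- q) + w s * (- q * s powr (- q - 1))"
  assumes [measurable]: "w \<in> borel_measurable borel" "g \<in> borel_measurable borel"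
    and w: "\<And>a b. 0 < a \<Longrightarrow> a \<le> b \<Longrightarrow> (g has_integral (w b - w a)) {a..b}"
    and "C > 0" "q > 0" and q: "q\<^sup>2 + (A - 2) * q = C"
    and fin: "(\<integral>\<^sup>+s. ennreal (((g s)\<^sup>2 + C * (w s / s)\<^sup>2) * gauss_weight A s) \<partial>lborel) < \<infinity>"
  shows "indef_int v h"
    and "ennreal q * (\<integral>\<^sup>+s. ennreal ((w s)\<^sup>2 * gauss_weight A s) \<partial>lborel)
        + (\<integral>\<^sup>+s. ennreal ((h s)\<^sup>2 * gauss_weight (2 * q + A) s) \<partial>lborel)
      \<le> (\<integral>\<^sup>+s. ennreal (((g s)\<^sup>2 + C * (w s / s)\<^sup>2) * gauss_weight A s) \<partial>lborel)"
proof -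
  define e where "e = (\<lambda>s. ((g s)\<^sup>2 + C * (w s / s)\<^sup>2) * gauss_weight A s)"
  have e0: "0 \<le> e s" for s using \<open>C > 0\<close> by (simp add: e_def)
  have [measurable]: "e \<in> borel_measurable borel" unfolding e_def by measurable
  have ie: "integrable lborel e"
    using fin e0 by (intro integrableI_nonneg) (auto simp: e_def)
  have "(\<integral>\<^sup>+s. ennreal ((g s)\<^sup>2 * gauss_weight A s) \<partial>lborel) \<le> (\<integral>\<^sup>+s. ennreal (e s) \<partial>lborel)"
    using \<open>C > 0\<close> by (intro nn_integral_mono ennreal_leI) (auto simp: e_def intro!: mult_right_mono)
  also have "\<dots> < \<infinity>" using fin by (simp add: e_def)
  finally have wg: "indef_int w g"
    by (intro indef_int_of_finite_energy[where A = A] w) auto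
  have pq: "indef_int (\<lambda>s. s powr (- q)) (\<lambda>s. - q * s powr (- q - 1))"
    by (rule indef_int_C1) (auto intro!: derivative_eq_intros continuous_intros)
  show vh: "indef_int v h"
    unfolding v_def h_def by (rule indef_int_mult[OF wg pq])
  have [measurable]: "h \<in> borel_measurable borel" unfolding h_def by measurable
  define k k' where "k = (\<lambda>s::real. s powr (A - 2) * exp (- s\<^sup>2 / 2))"
    and "k' = (\<lambda>s::real. ((A - 2) * s powr (A - 3) - s powr (A - 1)) * exp (- s\<^sup>2 / 2))"
  have kk: "indef_int k k'"
    unfolding k_def k'_def
  proof (rule indef_int_C1)
    fix x :: real assume x: "0 < x"
    have eq: "x * x powr (A - 2) = x powr (A - 1)"
      using x powr_add[of x 1 "A - 2"] by simp
    show "((\<lambda>s. s powr (A - 2) * exp (- s\<^sup>2 / 2)) has_real_derivative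
        ((A - 2) * x powr (A - 3) - x powr (A - 1)) * exp (- x\<^sup>2 / 2)) (at x)"
      unfolding eq[symmetric] using x
      by (auto intro!: derivative_eq_intros simp: algebra_simps)
  qed (auto intro!: continuous_intros)
  define G G' where "G = (\<lambda>s. w s * w s * k s)"
    and "G' = (\<lambda>s. (g s * w s + w s * g s) * k s + w s * w s * k' s)"
  have GG: "indef_int G G'"
    unfolding G_def G'_def by (rule indef_int_mult[OF indef_int_mult[OF wg wg] kk])
  have G0: "0 \<le> G s" for s by (simp add: G_def k_def)
  define R where "R = (\<lambda>s. q * ((w s)\<^sup>2 * gauss_weight A s) + (h s)\<^sup>2 * gauss_weight (2 * q + A) s)"
  have R0: "0 \<le> R s" for s using \<open>q > 0\<close> by (simp add: R_def)
  have [measurable]: "R \<in> borel_measurable borel" unfolding R_def by measurable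
  \<comment> \<open>All powers are reduced to \<open>p = s powr (A - 3)\<close>, which leaves a
    polynomial identity. The fact \<open>bb\<close> absorbs the factors \<open>s powr (- q)\<close>
    of \<open>h\<close> into the weight with parameter \<open>2 * q + A\<close>, and
    \<open>C\<close> is eliminated by the quadratic equation for \<open>q\<close>.\<close>
  have R_eq: "R s = e s - q * G' s" if s: "0 < s" for s
  proof -
    define p E where "p = s powr (A - 3)" and "E = exp (- s\<^sup>2 / 2)"
    define b where "b = s powr (- q)"
    have p2: "s powr (A - 2) = s * p" and p1: "s powr (A - 1) = s\<^sup>2 * p"
      using s powr_add[of s 1 "A - 3"] powr_add[of s 2 "A - 3"] by (simp_all add: p_def)
    have b1: "s powr (- q - 1) = b / s"
      using s by (simp add: b_def powr_diff)
    have "s powr (2 * q + A - 1) = s powr q * s powr q * s powr (A - 1)"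
      by (simp add: powr_add[symmetric] add_diff_eq)
    moreover have "s powr q * b = 1"
      using s by (simp add: b_def powr_minus field_simps)
    ultimately have bb: "b * b * s powr (2 * q + A - 1) = s\<^sup>2 * p"
      by (simp add: p1 mult_ac) (metis mult.assoc mult.commute mult_1)
    have "(h s)\<^sup>2 * gauss_weight (2 * q + A) s = (g s - q * w s / s)\<^sup>2 * (b * b * s powr (2 * q + A - 1)) * E"
      using s by (simp add: h_def b1 gauss_weight_def E_def b_def[symmetric] power2_eq_square algebra_simps)
    also have "\<dots> = (g s - q * w s / s)\<^sup>2 * (s\<^sup>2 * p) * E"
      unfolding bb ..
    also have "\<dots> = (s * g s - q * w s)\<^sup>2 * p * E"
      using s by (simp add: power2_eq_square field_simps)
    finally have h2: "(h s)\<^sup>2 * gauss_weight (2 * q + A) s = (s * g s - q * w s)\<^sup>2 * p * E" .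
    have e2: "e s = ((s * g s)\<^sup>2 + C * (w s)\<^sup>2) * p * E"
      using s by (simp add: e_def gauss_weight_def p1 E_def power2_eq_square field_simps)
    have w2: "(w s)\<^sup>2 * gauss_weight A s = (w s)\<^sup>2 * s\<^sup>2 * p * E"
      using s by (simp add: gauss_weight_def p1 E_def)
    have G2: "G' s = (2 * g s * w s * s + (w s)\<^sup>2 * (A - 2 - s\<^sup>2)) * p * E"
      by (simp add: G'_def k_def k'_def p1 p2 p_def[symmetric] E_def power2_eq_square algebra_simps)
    show ?thesis
      unfolding R_def h2 e2 w2 G2 q[symmetric] by (simp add: power2_eq_square algebra_simps)
  qed
  have bound: "(\<integral>\<^sup>+s. ennreal (R s) * indicator {a..b} s \<partial>lborel) \<le> ennreal ((\<integral>s. e s \<partial>lborel) + q * G a)"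
    if ab: "0 < a" "a \<le> b" for a b
  proof -
    note D = indef_intD[OF GG ab]
    have ie': "set_integrable lborel {a..b} e"
      using ie unfolding set_integrable_def by (intro integrable_mult_indicator) auto
    have cong: "indicator {a..b} s *\<^sub>R R s = indicator {a..b} s *\<^sub>R (e s - q * G' s)" for s
      using R_eq ab by (cases "s \<in> {a..b}") auto
    have iR: "set_integrable lborel {a..b} (\<lambda>s. e s - q * G' s)"
      using ie' D(1) by auto
    have "(\<integral>\<^sup>+s. ennreal (R s) * indicator {a..b} s \<partial>lborel) = (\<integral>\<^sup>+s. ennreal (indicator {a..b} s *\<^sub>R R s) \<partial>lborel)"
      by (intro nn_integral_cong) (auto simp: indicator_def)
    also have "\<dots> = ennreal (LBINT s:{a..b}. e s - q * G' s)"
      using iR R0 unfolding set_lebesgue_integral_def set_integrable_def cong[symmetric]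
      by (intro nn_integral_eq_integral) auto
    also have "(LBINT s:{a..b}. e s - q * G' s) = (LBINT s:{a..b}. e s) - q * (G b - G a)"
      using ie' D by simp
    also have "\<dots> \<le> (\<integral>s. e s \<partial>lborel) + q * G a"
    proof -
      have "(LBINT s:{a..b}. e s) \<le> (\<integral>s. e s \<partial>lborel)"
        using ie' ie e0 unfolding set_lebesgue_integral_def set_integrable_def
        by (intro integral_mono) (auto simp: indicator_def)
      moreover have "0 \<le> q * G b" using \<open>q > 0\<close> G0 by simp
      ultimately show ?thesis by (simp add: algebra_simps)
    qed
    finally show ?thesis by (simp add: ennreal_leI)
  qed
  \<comment> \<open>As \<open>R\<close> is nonnegative, the interval may be extended to the left,
    down to a point \<open>a\<close> at which the boundary term is below the given
    \<open>\<epsilon>\<close>.\<close>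
  have trunc: "(\<integral>\<^sup>+s. ennreal (R s) * indicator {c..b} s \<partial>lborel) \<le> ennreal (\<integral>s. e s \<partial>lborel)"
    if cb: "0 < c" "c \<le> b" for b c
  proof (rule ennreal_le_epsilon)
    fix \<epsilon> :: real assume "0 < \<epsilon>"
    \<comment> \<open>The quotient \<open>G s / s\<close> equals
      \<open>(w s / s)\<^sup>2 * gauss_weight A s\<close>, so the left side is one of the two
      nonnegative parts of \<open>e s\<close>.\<close>
    have "C * G s / s \<le> e s" if s: "0 < s" for s
    proof -
      have "C * G s / s = C * (w s / s)\<^sup>2 * gauss_weight A s"
        using s powr_add[of s 1 "A - 2"] by (simp add: G_def k_def gauss_weight_def power2_eq_square field_simps)
      then show ?thesis by (simp add: e_def distrib_right)
    qed
    then obtain a where a: "0 < a" "a < c" "G a < \<epsilon> / q"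
      using small_boundary_values[OF ie e0 \<open>C > 0\<close>, of G "\<epsilon> / q" c] \<open>0 < \<epsilon>\<close> \<open>q > 0\<close> cb by auto
    have "(\<integral>\<^sup>+s. ennreal (R s) * indicator {c..b} s \<partial>lborel) \<le> (\<integral>\<^sup>+s. ennreal (R s) * indicator {a..b} s \<partial>lborel)"
      using a by (intro nn_integral_mono) (auto simp: indicator_def)
    also have "\<dots> \<le> ennreal ((\<integral>s. e s \<partial>lborel) + q * G a)"
      using a cb by (intro bound) auto
    also have "\<dots> \<le> ennreal ((\<integral>s. e s \<partial>lborel) + \<epsilon>)"
      using a \<open>q > 0\<close> by (intro ennreal_leI) (simp add: field_simps)
    also have "\<dots> = ennreal (\<integral>s. e s \<partial>lborel) + ennreal \<epsilon>"
      using e0 \<open>0 < \<epsilon>\<close> by (intro ennreal_plus) auto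
    finally show "(\<integral>\<^sup>+s. ennreal (R s) * indicator {c..b} s \<partial>lborel) \<le> ennreal (\<integral>s. e s \<partial>lborel) + ennreal \<epsilon>" .
  qed
  \<comment> \<open>Monotone convergence along intervals exhausting the half-line; elsewhere
    \<open>R\<close> vanishes with the weights.\<close>
  have "(\<integral>\<^sup>+s. ennreal (R s) \<partial>lborel) \<le> ennreal (\<integral>s. e s \<partial>lborel)"
  proof (rule LIMSEQ_le_const2)
    show "(\<lambda>n. \<integral>\<^sup>+s. ennreal (R s) * indicator {1 / real (Suc n)..real (Suc n)} s \<partial>lborel)
        \<longlonglongrightarrow> (\<integral>\<^sup>+s. ennreal (R s) \<partial>lborel)"
    proof (rule nn_integral_LIMSEQ)
      show "incseq (\<lambda>n s. ennreal (R s) * indicator {1 / real (Suc n)..real (Suc n)} s)"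
      proof (intro incseq_SucI le_funI mult_left_mono)
        fix n s
        have "1 / real (Suc (Suc n)) \<le> 1 / real (Suc n)" by (intro divide_left_mono) auto
        then show "(indicator {1 / real (Suc n)..real (Suc n)} s :: ennreal)
            \<le> indicator {1 / real (Suc (Suc n))..real (Suc (Suc n))} s"
          by (auto split: split_indicator)
      qed auto
      fix s :: real
      show "(\<lambda>n. ennreal (R s) * indicator {1 / real (Suc n)..real (Suc n)} s) \<longlonglongrightarrow> ennreal (R s)"
      proof (cases "0 < s")
        case True
        have "\<forall>\<^sub>F n in sequentially. 1 / real (Suc n) \<le> s \<and> s \<le> real (Suc n)"
          using True by (intro eventually_conj) real_asymp+
        then have "\<forall>\<^sub>F n in sequentially. ennreal (R s) * indicator {1 / real (Suc n)..real (Suc n)} s = ennreal (R s)"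
          by eventually_elim auto
        then show ?thesis by (rule tendsto_eventually)
      qed (simp add: R_def gauss_weight_def)
    qed measurable
    have "1 / real (Suc n) \<le> real (Suc n)" for n by (simp add: field_simps)
    then show "\<exists>N. \<forall>n\<ge>N. (\<integral>\<^sup>+s. ennreal (R s) * indicator {1 / real (Suc n)..real (Suc n)} s \<partial>lborel) \<le> ennreal (\<integral>s. e s \<partial>lborel)"
      by (intro exI allI impI trunc) auto
  qed
  also have "\<dots> = (\<integral>\<^sup>+s. ennreal (e s) \<partial>lborel)"
    using ie e0 by (simp add: nn_integral_eq_integral)
  also have "(\<integral>\<^sup>+s. ennreal (R s) \<partial>lborel) = (\<integral>\<^sup>+s. ennreal q * ennreal ((w s)\<^sup>2 * gauss_weight A s) + ennreal ((h s)\<^sup>2 * gauss_weight (2 * q + A) s) \<partial>lborel)"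
    using \<open>q > 0\<close> by (simp add: R_def ennreal_mult[symmetric])
  also have "\<dots> = ennreal q * (\<integral>\<^sup>+s. ennreal ((w s)\<^sup>2 * gauss_weight A s) \<partial>lborel)
        + (\<integral>\<^sup>+s. ennreal ((h s)\<^sup>2 * gauss_weight (2 * q + A) s) \<partial>lborel)"
    by (subst nn_integral_add) (auto simp: nn_integral_cmult)
  finally show "ennreal q * (\<integral>\<^sup>+s. ennreal ((w s)\<^sup>2 * gauss_weight A s) \<partial>lborel)
        + (\<integral>\<^sup>+s. ennreal ((h s)\<^sup>2 * gauss_weight (2 * q + A) s) \<partial>lborel)
      \<le> (\<integral>\<^sup>+s. ennreal (((g s)\<^sup>2 + C * (w s / s)\<^sup>2) * gauss_weight A s) \<partial>lborel)"
    by (simp add: e_def)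
qed

section \<open>Optimizers and assembly of the three claims\<close>

text \<open>Trades Lebesgue measure for \<open>lborel\<close>, and \<open>w\<close>, which is
  arbitrary off the half-line, for a function \<open>u\<close> that can be chosen Borel.\<close>

lemma gauss_mass_eq:
  assumes "\<And>s. 0 < s \<Longrightarrow> u s = w s"
  shows "gauss_mass A w = (\<integral>\<^sup>+s. ennreal ((u s)\<^sup>2 * gauss_weight A s) \<partial>lborel)"
  unfolding gauss_mass_def nn_integral_completion
  by (intro nn_integral_cong) (use assms in \<open>auto simp: gauss_weight_def mult_ac\<close>)

lemma gauss_energy_eq:
  assumes "AE s in lborel. 0 < s \<longrightarrow> deriv w s = g s" and "\<And>s. 0 < s \<Longrightarrow> u s = w s"
  shows "gauss_energy A C w = (\<integral>\<^sup>+s. ennreal (((g s)\<^sup>2 + C * (u s / s)\<^sup>2) * gauss_weight A s) \<partial>lborel)"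
  unfolding gauss_energy_def nn_integral_completion
proof (rule nn_integral_cong_AE)
  show "AE s in lborel. ennreal (((deriv w s)\<^sup>2 + C * (w s / s)\<^sup>2) * exp (- s\<^sup>2 / 2) * s powr (A - 1)) * indicator {0<..} s
      = ennreal (((g s)\<^sup>2 + C * (u s / s)\<^sup>2) * gauss_weight A s)"
    using assms(1) by eventually_elim (use assms(2) in \<open>auto simp: gauss_weight_def mult_ac\<close>)
qed

text \<open>Here \<open>B = 2 * q + A - 2\<close>, two less than the parameter of the Poincare
  inequality. The second moment identity gives the mass \<open>c\<^sup>2 * (B * Z)\<close>, and
  \<open>q\<^sup>2 + C = q * B\<close> gives the energy
  \<open>c\<^sup>2 * (q * B) * Z\<close>.\<close>

lemma gauss_energy_powr:
  fixes A C c :: real and w :: "real \<Rightarrow> real"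
  defines "q \<equiv> crit_exp A C"
  assumes "A \<ge> 2" "C > 0" and w: "\<And>s. 0 < s \<Longrightarrow> w s = c * s powr q"
  shows "gauss_mass A w < \<infinity>" and "gauss_energy A C w = ennreal q * gauss_mass A w"
proof -
  have q: "0 < q" "q\<^sup>2 + (A - 2) * q = C"
    using crit_exp_pos crit_exp_root \<open>C > 0\<close> by (auto simp: q_def)
  define B where "B = 2 * q + A - 2"
  have B: "0 < B" using q \<open>A \<ge> 2\<close> by (simp add: B_def)
  define Z where "Z = (\<integral>s. gauss_weight B s \<partial>lborel)"
  have Z: "0 \<le> Z" by (simp add: Z_def)
  have p: "s powr q * s powr q * gauss_weight A s = s\<^sup>2 * gauss_weight B s" if "0 < s" for s
  proof -
    have "s powr q * s powr q * s powr (A - 1) = s powr (2 + (B - 1))"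
      by (simp add: powr_add[symmetric] B_def add_diff_eq)
    also have "\<dots> = s\<^sup>2 * s powr (B - 1)" unfolding powr_add using that by simp
    finally show ?thesis using that by (simp add: gauss_weight_def)
  qed
  have "gauss_mass A w = (\<integral>\<^sup>+s. ennreal ((c * s powr q)\<^sup>2 * gauss_weight A s) \<partial>lborel)"
    using w by (intro gauss_mass_eq) simp
  also have "\<dots> = (\<integral>\<^sup>+s. ennreal (c\<^sup>2 * (s\<^sup>2 * gauss_weight B s)) \<partial>lborel)"
  proof (rule nn_integral_cong)
    fix s
    show "ennreal ((c * s powr q)\<^sup>2 * gauss_weight A s) = ennreal (c\<^sup>2 * (s\<^sup>2 * gauss_weight B s))"
    proof (cases "0 < s")
      case True
      have "(c * s powr q)\<^sup>2 * gauss_weight A s = c\<^sup>2 * (s powr q * s powr q * gauss_weight A s)"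
        by (simp add: power2_eq_square mult_ac)
      then show ?thesis unfolding p[OF True] by simp
    qed (simp add: gauss_weight_def)
  qed
  also have "\<dots> = ennreal (c\<^sup>2 * (B * Z))"
    using integrable_gauss_weight(2)[OF B] gauss_weight_second_moment[OF B] by (simp add: nn_integral_eq_integral Z_def)
  finally have M: "gauss_mass A w = ennreal (c\<^sup>2 * (B * Z))" .
  then show "gauss_mass A w < \<infinity>" by simp
  have "deriv w s = c * (q * s powr (q - 1))" if s: "0 < s" for s
  proof -
    have "((\<lambda>s. c * s powr q) has_real_derivative c * (q * s powr (q - 1))) (at s)"
      using s by (auto intro!: derivative_eq_intros)
    then have "(w has_real_derivative c * (q * s powr (q - 1))) (at s)"
      by (rule has_field_derivative_transform_within_open[of _ _ _ "{0<..}"]) (use s w in auto)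
    then show ?thesis by (rule DERIV_imp_deriv)
  qed
  then have "gauss_energy A C w = (\<integral>\<^sup>+s. ennreal (((c * (q * s powr (q - 1)))\<^sup>2 + C * (c * s powr q / s)\<^sup>2) * gauss_weight A s) \<partial>lborel)"
    using w by (intro gauss_energy_eq) auto
  also have "\<dots> = (\<integral>\<^sup>+s. ennreal (c\<^sup>2 * (q * B) * gauss_weight B s) \<partial>lborel)"
  proof (rule nn_integral_cong)
    fix s
    show "ennreal (((c * (q * s powr (q - 1)))\<^sup>2 + C * (c * s powr q / s)\<^sup>2) * gauss_weight A s) = ennreal (c\<^sup>2 * (q * B) * gauss_weight B s)"
    proof (cases "0 < s")
      case True
      have "q\<^sup>2 + C = q * B" using q(2) by (simp add: B_def power2_eq_square algebra_simps)
      moreover have "((c * (q * s powr (q - 1)))\<^sup>2 + C * (c * s powr q / s)\<^sup>2) * gauss_weight A s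
          = c\<^sup>2 * (q\<^sup>2 + C) * ((s powr q * s powr q * gauss_weight A s) / s\<^sup>2)"
        using True by (simp add: powr_diff power2_eq_square field_simps)
      ultimately show ?thesis using True p[OF True] by simp
    qed (simp add: gauss_weight_def)
  qed
  also have "\<dots> = ennreal (c\<^sup>2 * (q * B) * Z)"
    using integrable_gauss_weight(1)[OF B] q B by (simp add: nn_integral_eq_integral Z_def)
  also have "\<dots> = ennreal q * gauss_mass A w"
    unfolding M using q B Z by (subst ennreal_mult[symmetric]) (auto simp: mult_ac)
  finally show "gauss_energy A C w = ennreal q * gauss_mass A w" .
qed

text \<open>For rapidly growing \<open>w\<close> both sides of the first inequality are infinite.
  Finite mass excludes this spurious equality and gives the deficit its meaning as a
  difference.\<close>

theorem theorem2p2: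
  fixes A C :: real and w :: "real \<Rightarrow> real"
  assumes "A \<ge> 2" and "C > 0" and "admissible w"
  shows "gauss_energy A C w \<ge> ennreal (crit_exp A C) * gauss_mass A w
    \<and> ((gauss_mass A w < \<infinity> \<and> gauss_energy A C w = ennreal (crit_exp A C) * gauss_mass A w)
         \<longleftrightarrow> (\<exists>c. \<forall>s>0. w s = c * s powr crit_exp A C))
    \<and> (gauss_mass A w < \<infinity> \<longrightarrow>
         gauss_energy A C w - ennreal (crit_exp A C) * gauss_mass A w
           \<ge> 2 * (INF c. gauss_mass A (\<lambda>s. w s - c * s powr crit_exp A C)))"
proof -
  define q where "q = crit_exp A C"
  define B where "B = 2 * q + A"
  have q: "0 < q" "q\<^sup>2 + (A - 2) * q = C"
    using crit_exp_pos crit_exp_root \<open>C > 0\<close> by (auto simp: q_def)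
  have B: "0 < B" using q \<open>A \<ge> 2\<close> by (simp add: B_def)
  obtain g where g [measurable]: "g \<in> borel_measurable borel"
    and ae: "AE s in lborel. 0 < s \<longrightarrow> deriv w s = g s"
    and wg: "\<And>a b. 0 < a \<Longrightarrow> a \<le> b \<Longrightarrow> (g has_integral (w b - w a)) {a..b}"
    using admissible_borel_derivative[OF \<open>admissible w\<close>] by blast
  \<comment> \<open>Cutting \<open>w\<close> off makes it Borel on the whole line: it is continuous
    on the half-line by \<open>continuous_on_HK_primitive\<close>.\<close>
  define u where "u = (\<lambda>s. indicator {0<..} s *\<^sub>R w s)"
  have u: "u s = w s" if "0 < s" for s using that by (simp add: u_def)
  have [measurable]: "u \<in> borel_measurable borel"
    unfolding u_def
    by (rule borel_measurable_continuous_on_indicator[OF _ continuous_on_HK_primitive[OF wg]]) auto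
  have ug: "(g has_integral (u b - u a)) {a..b}" if "0 < a" "a \<le> b" for a b
    using wg[OF that] that by (simp add: u)
  define v h where "v = (\<lambda>s. u s * s powr (- q))"
    and "h = (\<lambda>s. g s * s powr (- q) + u s * (- q * s powr (- q - 1)))"
  have [measurable]: "v \<in> borel_measurable borel" "h \<in> borel_measurable borel"
    unfolding v_def h_def by measurable
  define E M D where "E = gauss_energy A C w" and "M = gauss_mass A w"
    and "D = (\<integral>\<^sup>+s. ennreal ((h s)\<^sup>2 * gauss_weight B s) \<partial>lborel)"
  have E_eq: "E = (\<integral>\<^sup>+s. ennreal (((g s)\<^sup>2 + C * (u s / s)\<^sup>2) * gauss_weight A s) \<partial>lborel)"
    unfolding E_def by (rule gauss_energy_eq[OF ae u])
  have M_eq: "M = (\<integral>\<^sup>+s. ennreal ((u s)\<^sup>2 * gauss_weight A s) \<partial>lborel)"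
    unfolding M_def by (rule gauss_mass_eq[OF u])
  have fin: "indef_int v h \<and> ennreal q * M + D \<le> E" if "E < \<infinity>"
  proof
    have um: "u \<in> borel_measurable borel" by measurable
    note finite = that[unfolded E_eq]
    show "indef_int v h"
      unfolding v_def h_def by (rule energy_decomposition(1)[OF um g _ \<open>C > 0\<close> q finite]) (rule ug)
    show "ennreal q * M + D \<le> E"
      unfolding E_eq M_eq D_def h_def B_def
      by (rule energy_decomposition(2)[OF um g _ \<open>C > 0\<close> q finite]) (rule ug)
  qed
  \<comment> \<open>Distances from \<open>w\<close> to multiples of the optimizer become distances
    from \<open>v\<close> to constants, because \<open>B = 2 * q + A\<close> compensates the factor
    \<open>s powr (- q)\<close> in \<open>v\<close>.\<close>
  have wt: "(v s - m)\<^sup>2 * gauss_weight B s = (u s - m * s powr q)\<^sup>2 * gauss_weight A s" if s: "0 < s" for s m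
  proof -
    have "v s - m = (u s - m * s powr q) * s powr (- q)"
      using s by (simp add: v_def left_diff_distrib powr_minus)
    moreover have "s powr (- q) * s powr (- q) * gauss_weight B s = gauss_weight A s"
      using s by (simp add: gauss_weight_def B_def powr_add[symmetric] mult.assoc[symmetric])
    ultimately show ?thesis
      by (simp add: power2_eq_square mult_ac)
  qed
  have mass: "gauss_mass A (\<lambda>s. w s - m * s powr q) = (\<integral>\<^sup>+s. ennreal ((v s - m)\<^sup>2 * gauss_weight B s) \<partial>lborel)" for m
  proof -
    have "gauss_mass A (\<lambda>s. w s - m * s powr q) = (\<integral>\<^sup>+s. ennreal ((u s - m * s powr q)\<^sup>2 * gauss_weight A s) \<partial>lborel)"
      by (rule gauss_mass_eq) (simp add: u)
    also have "\<dots> = (\<integral>\<^sup>+s. ennreal ((v s - m)\<^sup>2 * gauss_weight B s) \<partial>lborel)"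
    proof (rule nn_integral_cong)
      fix s
      show "ennreal ((u s - m * s powr q)\<^sup>2 * gauss_weight A s) = ennreal ((v s - m)\<^sup>2 * gauss_weight B s)"
        using wt[of s m] by (cases "0 < s") (auto simp: gauss_weight_def)
    qed
    finally show ?thesis .
  qed
  have "ennreal q * M \<le> E"
  proof (cases "E < \<infinity>")
    case True
    then show ?thesis using fin[OF True] by (meson le_iff_add order_trans)
  qed (simp add: not_less top_unique)
  moreover have "(\<exists>c. \<forall>s>0. w s = c * s powr q)" if M: "M < \<infinity>" and eq: "E = ennreal q * M"
  proof -
    have "E < \<infinity>" using M unfolding eq by (simp add: ennreal_mult_less_top)
    with fin have vh: "indef_int v h" and le: "ennreal q * M + D \<le> ennreal q * M"
      using eq by auto
    \<comment> \<open>The term \<open>ennreal q * M\<close> is finite here and can be cancelled. A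
      vanishing \<open>D\<close> then forces \<open>h\<close> to be null and \<open>v\<close> to be
      constant.\<close>
    then have "D = 0"
      using \<open>E < \<infinity>\<close> by (cases "ennreal q * M"; cases D) (auto simp: eq top_unique simp flip: ennreal_plus)
    then have "AE s in lborel. ennreal ((h s)\<^sup>2 * gauss_weight B s) = 0"
      unfolding D_def by (subst (asm) nn_integral_0_iff_AE) auto
    then have h0: "AE s in lborel. 0 < s \<longrightarrow> h s = 0"
      by eventually_elim (auto simp: gauss_weight_def ennreal_eq_0_iff mult_le_0_iff not_le)
    have const: "v b = v a" if "0 < a" "a \<le> b" for a b
    proof -
      have "v b - v a = (LBINT s:{a..b}. h s)"
        using indef_intD(2)[OF vh that] by simp
      also have "\<dots> = (LBINT s:{a..b}. 0)"
        using h0 that by (intro set_lebesgue_integral_cong_AE) (auto elim!: eventually_mono)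
      finally show ?thesis by simp
    qed
    have v1: "v s = v 1" if "0 < s" for s
    proof (cases "s \<le> 1")
      case True
      show ?thesis using const[OF that True] by argo
    next
      case False
      then show ?thesis by (intro const) auto
    qed
    have "w s = v 1 * s powr q" if "0 < s" for s
    proof -
      have "w s = v s * s powr q"
        using that u[OF that] by (simp add: v_def powr_minus)
      then show ?thesis using v1[OF that] by simp
    qed
    then show ?thesis by blast
  qed
  moreover have "M < \<infinity> \<and> E = ennreal q * M" if "\<exists>c. \<forall>s>0. w s = c * s powr q"
    using that gauss_energy_powr[OF \<open>A \<ge> 2\<close> \<open>C > 0\<close>, of w] unfolding E_def M_def q_def by blast
  moreover have "2 * (INF c. gauss_mass A (\<lambda>s. w s - c * s powr q)) \<le> E - ennreal q * M" if M: "M < \<infinity>"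
  proof (cases "E < \<infinity>")
    case True
    then have vh: "indef_int v h" and le: "ennreal q * M + D \<le> E" using fin by auto
    have "(\<integral>\<^sup>+s. ennreal ((v s)\<^sup>2 * gauss_weight B s) \<partial>lborel) < \<infinity>"
      using mass[of 0] M by (simp add: M_def)
    then obtain m where m: "2 * (\<integral>\<^sup>+s. ennreal ((v s - m)\<^sup>2 * gauss_weight B s) \<partial>lborel) \<le> D"
      using gauss_weight_Poincare[OF B vh] unfolding D_def by auto
    have "2 * (INF c. gauss_mass A (\<lambda>s. w s - c * s powr q)) \<le> 2 * gauss_mass A (\<lambda>s. w s - m * s powr q)"
      by (intro mult_left_mono INF_lower) auto
    also have "\<dots> \<le> D" using m by (simp add: mass)
    \<comment> \<open>Subtraction of extended values undoes the addition because
      \<open>ennreal q * M\<close> is finite.\<close>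
    also have "D = (ennreal q * M + D) - ennreal q * M"
      using M by (intro ennreal_add_diff_cancel_left[symmetric]) (simp add: ennreal_mult_eq_top_iff)
    also have "\<dots> \<le> E - ennreal q * M"
      by (intro ennreal_minus_mono le) auto
    finally show ?thesis .
  next
    case False
    then have "E - ennreal q * M = top"
      using M by (simp add: not_less top_unique ennreal_mult_eq_top_iff)
    then show ?thesis by simp
  qed
  ultimately show ?thesis
    unfolding E_def M_def q_def by blast
qed

end
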